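(* Let $n\ge 3$ and let $\{F^{ij}\}_{1\le i<j\le n}$ be a complete set of $\binom n2$ real fundamental matrices. (Collinear case) $\{F^{ij}\}$ is compatible with a solution of real cameras whose centers are all collinear if and only if there exist non-zero real scalars $\lambda_{ij}=\lambda_{ji}$ such that the $n$-view fundamental matrix $\mathbf{F}=(\lambda_{ij}F^{ij})_{ij}$ has rank $4$ and all its $3\times 3n$ block rows and $3n\times 3$ block columns have rank $2$. (Non-collinear case) Suppose that in each image no three epipoles lie on a line. Then $\{F^{ij}\}$ is compatible with a solution of real cameras whose centers are not all collinear if and only if there exist non-zero real scalars $\lambda_{ij}=\lambda_{ji}$ such that the $n$-view fundamental matrix $\mathbf{F}=(\lambda_{ij}F^{ij})_{ij}$ has rank $6$ and all its $3\times 3n$ block rows and $3n\times 3$ block columns have rank $3$.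
   Context: A camera is a rank-3 real $3\times 4$ matrix (up to nonzero scale); its center is its kernel, a point of $\mathbb{P}^3$. A fundamental matrix is a rank-2 real $3\times 3$ matrix. For $3\times 4$ matrices $P_1,P_2$, $\psi(P_1,P_2)$ is the $3\times3$ matrix $F$ (up to scale) with $\det\begin{bmatrix}P_1&x&0\\P_2&0&y\end{bmatrix}=x^TFy$ for all $x,y\in\mathbb{R}^3$. Affine representatives are fixed with $F^{ji}=(F^{ij})^T$. A set $\{F^{ij}\}$ is compatible if there are cameras $P_1,\dots,P_n$ (a solution) with $F^{ij}=\psi(P_i,P_j)$ up to nonzero scale for all $(i,j)$. The epipole $e_j^i$ (the $i$-th epipole in the $j$-th image) is a vector spanning $\ker F^{ij}$, viewed as a point of $\mathbb{P}^2$; the $j$-th image contains the $n-1$ epipoles $e_j^i$, $i\ne j$. The $n$-view fundamental matrix $\mathbf{F}=(\lambda_{ij}F^{ij})_{ij}$ is the symmetric $3n\times 3n$ matrix whose $(i,j)$ block of size $3\times3$ is $\lambda_{ij}F^{ij}$ for $i\neq j$ and $0$ for $i=j$. *)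

theory Defs
  imports "HOL-Analysis.Analysis"
begin

text \<open>
  A point of projective space is represented by the one-dimensional linear subspace it is,
  a projective line by a two-dimensional linear subspace.
\<close>

definition null_sp :: "real^'n^'m \<Rightarrow> (real^'n) set" where
  "null_sp A = {v. A *v v = 0}"

definition proj_collinear :: "(real^'n) set set \<Rightarrow> bool" where
  "proj_collinear S \<longleftrightarrow> (\<exists>L. subspace L \<and> dim L = 2 \<and> (\<forall>p\<in>S. p \<subseteq> L))"

definition is_camera :: "real^4^3 \<Rightarrow> bool" where
  "is_camera P \<longleftrightarrow> rank P = 3"

definition center :: "real^4^3 \<Rightarrow> (real^4) set" where
  "center P = null_sp P"

definition is_fundamental :: "real^3^3 \<Rightarrow> bool" where
  "is_fundamental F \<longleftrightarrow> rank F = 2"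

text \<open>The block matrix with block rows \<open>[P, x, 0]\<close> and \<open>[Q, 0, y]\<close>.\<close>

definition joint_matrix ::
    "real^4^3 \<Rightarrow> real^4^3 \<Rightarrow> real^3 \<Rightarrow> real^3 \<Rightarrow> real^6^6" where
  "joint_matrix P Q x y = vector
     [vector [P$1$1, P$1$2, P$1$3, P$1$4, x$1, 0],
      vector [P$2$1, P$2$2, P$2$3, P$2$4, x$2, 0],
      vector [P$3$1, P$3$2, P$3$3, P$3$4, x$3, 0],
      vector [Q$1$1, Q$1$2, Q$1$3, Q$1$4, 0, y$1],
      vector [Q$2$1, Q$2$2, Q$2$3, Q$2$4, 0, y$2],
      vector [Q$3$1, Q$3$2, Q$3$3, Q$3$4, 0, y$3]]"

text \<open>Existence and uniqueness of the described matrix are proved below (\<open>psi_eqI\<close>, \<open>det_joint_matrix\<close>).\<close>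

definition psi :: "real^4^3 \<Rightarrow> real^4^3 \<Rightarrow> real^3^3" where
  "psi P Q = (THE F. \<forall>x y. det (joint_matrix P Q x y) = x \<bullet> (F *v y))"

lemma psi_eqI:
  assumes "\<And>x y. det (joint_matrix P Q x y) = x \<bullet> (F *v y)"
  shows "psi P Q = F"
  unfolding psi_def
proof (rule the_equality)
  fix G assume "\<forall>x y. det (joint_matrix P Q x y) = x \<bullet> (G *v y)"
  then have "\<And>x y. x \<bullet> (G *v y) = x \<bullet> (F *v y)"
    using assms by simp
  then show "G = F"
    by (metis matrix_eq vector_eq_rdot inner_commute)
qed (use assms in simp)

lemma nat6_cases: "(k::6) = 1 \<or> k = 2 \<or> k = 3 \<or> k = 4 \<or> k = 5 \<or> k = 6"
proof (induct k)
  case (of_int z)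
  then have "z = 0 \<or> z = 1 \<or> z = 2 \<or> z = 3 \<or> z = 4 \<or> z = 5" by simp linarith
  then show ?case by auto
qed

lemma all_6: "(\<forall>k::6. R k) \<longleftrightarrow> R 1 \<and> R 2 \<and> R 3 \<and> R 4 \<and> R 5 \<and> R 6"
  by (metis nat6_cases)

lemma vector_6:
  "(vector [a,b,c,d,e,f] :: 'a::zero^6) $ 1 = a"
  "(vector [a,b,c,d,e,f] :: 'a::zero^6) $ 2 = b"
  "(vector [a,b,c,d,e,f] :: 'a::zero^6) $ 3 = c"
  "(vector [a,b,c,d,e,f] :: 'a::zero^6) $ 4 = d"
  "(vector [a,b,c,d,e,f] :: 'a::zero^6) $ 5 = e"
  "(vector [a,b,c,d,e,f] :: 'a::zero^6) $ 6 = f"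
  unfolding vector_def by simp_all

lemma joint_matrix_col5:
  "transpose (joint_matrix P Q x y) =
    (\<chi> k. if k = 5 then vector [x$1, x$2, x$3, 0, 0, 0] else transpose (joint_matrix P Q 0 y) $ k)"
  unfolding vec_eq_iff all_6 by (simp add: joint_matrix_def transpose_def vector_6)

lemma joint_matrix_col6:
  "transpose (joint_matrix P Q x y) =
    (\<chi> k. if k = 6 then vector [0, 0, 0, y$1, y$2, y$3] else transpose (joint_matrix P Q x 0) $ k)"
  unfolding vec_eq_iff all_6 by (simp add: joint_matrix_def transpose_def vector_6)

lemma linear_det_joint_left: "linear (\<lambda>x. det (joint_matrix P Q x y))"
proof (rule linearI)
  fix x x' :: "real^3" and c :: real
  have 1: "(vector [(x+x')$1, (x+x')$2, (x+x')$3, 0, 0, 0] :: real^6)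
      = vector [x$1, x$2, x$3, 0, 0, 0] + vector [x'$1, x'$2, x'$3, 0, 0, 0]"
    unfolding vec_eq_iff all_6 by (simp add: vector_6)
  have 2: "(vector [(c *\<^sub>R x)$1, (c *\<^sub>R x)$2, (c *\<^sub>R x)$3, 0, 0, 0] :: real^6)
      = c *s vector [x$1, x$2, x$3, 0, 0, 0]"
    unfolding vec_eq_iff all_6 by (simp add: vector_6)
  show "det (joint_matrix P Q (x + x') y) = det (joint_matrix P Q x y) + det (joint_matrix P Q x' y)"
    by (subst (1 2 3) det_transpose[symmetric], subst (1 2 3) joint_matrix_col5)
       (simp only: 1 det_row_add)
  show "det (joint_matrix P Q (c *\<^sub>R x) y) = c *\<^sub>R det (joint_matrix P Q x y)"
    by (subst (1 2) det_transpose[symmetric], subst (1 2) joint_matrix_col5)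
       (simp only: 2 det_row_mul real_scaleR_def)
qed

lemma linear_det_joint_right: "linear (\<lambda>y. det (joint_matrix P Q x y))"
proof (rule linearI)
  fix y y' :: "real^3" and c :: real
  have 1: "(vector [0, 0, 0, (y+y')$1, (y+y')$2, (y+y')$3] :: real^6)
      = vector [0, 0, 0, y$1, y$2, y$3] + vector [0, 0, 0, y'$1, y'$2, y'$3]"
    unfolding vec_eq_iff all_6 by (simp add: vector_6)
  have 2: "(vector [0, 0, 0, (c *\<^sub>R y)$1, (c *\<^sub>R y)$2, (c *\<^sub>R y)$3] :: real^6)
      = c *s vector [0, 0, 0, y$1, y$2, y$3]"
    unfolding vec_eq_iff all_6 by (simp add: vector_6)
  show "det (joint_matrix P Q x (y + y')) = det (joint_matrix P Q x y) + det (joint_matrix P Q x y')"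
    by (subst (1 2 3) det_transpose[symmetric], subst (1 2 3) joint_matrix_col6)
       (simp only: 1 det_row_add)
  show "det (joint_matrix P Q x (c *\<^sub>R y)) = c *\<^sub>R det (joint_matrix P Q x y)"
    by (subst (1 2) det_transpose[symmetric], subst (1 2) joint_matrix_col6)
       (simp only: 2 det_row_mul real_scaleR_def)
qed

lemma det_joint_matrix_entries:
  "det (joint_matrix P Q x y) = x \<bullet> ((\<chi> i j. det (joint_matrix P Q (axis i 1) (axis j 1))) *v y)"
proof -
  have lin: "f v = (\<Sum>i\<in>UNIV. v $ i * f (axis i 1))" if "linear f" for f :: "real^3 \<Rightarrow> real" and v
  proof -
    have "f v = f (\<Sum>i\<in>UNIV. v $ i *\<^sub>R axis i 1)"
      using basis_expansion[of v] by (simp add: scalar_mult_eq_scaleR)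
    also have "\<dots> = (\<Sum>i\<in>UNIV. v $ i * f (axis i 1))"
      by (simp add: linear_sum[OF that] linear_scale[OF that])
    finally show ?thesis .
  qed
  have "det (joint_matrix P Q x y) =
      (\<Sum>i\<in>UNIV. x $ i * (\<Sum>j\<in>UNIV. y $ j * det (joint_matrix P Q (axis i 1) (axis j 1))))"
    by (subst lin[OF linear_det_joint_left], subst lin[OF linear_det_joint_right]) simp
  then show ?thesis
    by (simp add: inner_vec_def matrix_vector_mult_def mult.commute)
qed

lemma psi_entries: "psi P Q = (\<chi> i j. det (joint_matrix P Q (axis i 1) (axis j 1)))"
  by (rule psi_eqI) (rule det_joint_matrix_entries)

lemma det_joint_matrix: "det (joint_matrix P Q x y) = x \<bullet> (psi P Q *v y)"
  unfolding psi_entries by (rule det_joint_matrix_entries)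

text \<open>
  Families \<open>(F\<^sup>i\<^sup>j)\<close> are functions \<open>F i j\<close>, of which only the values
  with \<open>i \<noteq> j\<close> are meaningful; the number of views is the cardinality of the index type.
\<close>

definition is_solution :: "('n \<Rightarrow> 'n \<Rightarrow> real^3^3) \<Rightarrow> ('n \<Rightarrow> real^4^3) \<Rightarrow> bool" where
  "is_solution F P \<longleftrightarrow> (\<forall>i. is_camera (P i)) \<and>
     (\<forall>i j. i \<noteq> j \<longrightarrow> (\<exists>c. c \<noteq> 0 \<and> F i j = c *\<^sub>R psi (P i) (P j)))"

text \<open>\<open>epipole F i j\<close> is the \<open>i\<close>-th epipole in the \<open>j\<close>-th image.\<close>

definition epipole :: "('n \<Rightarrow> 'n \<Rightarrow> real^3^3) \<Rightarrow> 'n \<Rightarrow> 'n \<Rightarrow> (real^3) set" where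
  "epipole F i j = null_sp (F i j)"

text \<open>The three epipoles are taken as labelled points, so coinciding ones count as collinear.\<close>

definition no_three_epipoles_collinear :: "('n \<Rightarrow> 'n \<Rightarrow> real^3^3) \<Rightarrow> bool" where
  "no_three_epipoles_collinear F \<longleftrightarrow>
     (\<forall>j a b c. distinct [j, a, b, c] \<longrightarrow>
        \<not> proj_collinear {epipole F a j, epipole F b j, epipole F c j})"

text \<open>Row \<open>(i, a)\<close> is row \<open>a\<close> of block row \<open>i\<close>, and likewise for columns.\<close>

definition nview_matrix ::
    "('n \<Rightarrow> 'n \<Rightarrow> real) \<Rightarrow> ('n \<Rightarrow> 'n \<Rightarrow> real^3^3) \<Rightarrow> real^('n::finite \<times> 3)^('n \<times> 3)" where
  "nview_matrix l F =
     (\<chi> r c. if fst r = fst c then 0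
             else l (fst r) (fst c) * F (fst r) (fst c) $ snd r $ snd c)"

definition block_row :: "real^('n::finite \<times> 3)^('n \<times> 3) \<Rightarrow> 'n \<Rightarrow> real^('n \<times> 3)^3" where
  "block_row M i = (\<chi> a c. M $ (i, a) $ c)"

definition block_col :: "real^('n::finite \<times> 3)^('n \<times> 3) \<Rightarrow> 'n \<Rightarrow> real^3^('n \<times> 3)" where
  "block_col M j = (\<chi> r b. M $ r $ (j, b))"

end

theory Submission
  imports Defs
begin

text \<open>
  In a projective chart in which every center is a finite point \<open>t\<^sub>i\<close>, the fundamental matrices of a solution are
  \<open>F\<^sup>i\<^sup>j \<sim> V\<^sub>i [t\<^sub>i - t\<^sub>j]\<^sub>\<times> V\<^sub>j\<^sup>T\<close> with invertible \<open>V\<^sub>i\<close>, so after scaling the block matrix is congruent to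
  \<open>([t\<^sub>i - t\<^sub>j]\<^sub>\<times>)\<close>, whose rank is 6 or 4 according to whether the \<open>t\<^sub>i\<close> span more than a line.

  Conversely, a symmetric matrix \<open>M\<close> with vanishing \<open>k\<close>-th diagonal block, whose \<open>k\<close>-th block column \<open>B\<close> has half
  the rank of \<open>M\<close>, can be written as \<open>A B\<^sup>T + B A\<^sup>T\<close>. In the rank 6 case the blocks satisfy that \<open>A\<^sub>i B\<^sub>i\<^sup>T\<close> is
  skew-symmetric, \<open>A\<^sub>i\<close> may be replaced by \<open>A\<^sub>i + B\<^sub>i [z]\<^sub>\<times>\<close> for any \<open>z\<close>, and for generic \<open>z\<close> this is an invertible matrix
  \<open>V\<^sub>i\<close>; then \<open>B\<^sub>i = V\<^sub>i [t\<^sub>i]\<^sub>\<times>\<close>. In the rank 4 case all \<open>B\<^sub>i\<close> share a kernel vector \<open>e\<close>, the skew-symmetry forces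
  \<open>A\<^sub>i = c\<^sub>i B\<^sub>i [e]\<^sub>\<times>\<close>, and since only the direction of \<open>t\<^sub>i - t\<^sub>j\<close> matters for collinear centers, any distinct points on a line
  in direction \<open>e\<close> can serve as centers.
\<close>

subsection \<open>Linear algebra\<close>

declare transpose_matrix_vector [simp del]

lemma inner_matrix_transpose:
  fixes A :: "real^'n^'m"
  shows "x \<bullet> (A *v y) = (transpose A *v x) \<bullet> y"
  by (simp add: dot_lmul_matrix transpose_matrix_vector)

lemma transpose_diff: "transpose (A - B) = transpose A - transpose B"
  for A B :: "'a::ring_1^'n^'m"
  by (simp add: transpose_def vec_eq_iff)

text \<open>The kernel is the orthogonal complement of the row space, whose dimension is the
  rank.\<close>

lemma rank_nullity:
  fixes A :: "real^'n^'m"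
  shows "dim {x. A *v x = 0} + rank A = CARD('n)"
proof -
  have "{x. A *v x = 0} = {y \<in> UNIV. \<forall>x\<in>span (rows A). orthogonal x y}" (is "?K = ?O")
  proof
    show "?K \<subseteq> ?O"
      by (auto simp: orthogonal_commute[of _ "_ :: real^'n"] intro: orthogonal_nullspace_rowspace)
    show "?O \<subseteq> ?K"
    proof clarsimp
      fix y assume "\<forall>x\<in>span (rows A). orthogonal x y"
      then have "A $ i \<bullet> y = 0" for i
        by (metis (mono_tags, lifting) mem_Collect_eq orthogonal_def row_def rows_def span_base
            UNIV_I vec_lambda_eta)
      then show "A *v y = 0"
        by (simp add: vec_eq_iff matrix_vector_mul_component)
    qed
  qed
  then show ?thesis
    using dim_subspace_orthogonal_to_vectors[of "span (rows A)" UNIV] by (simp add: row_rank_def)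
qed

lemma kernel_spanned:
  fixes A :: "real^'n^'m"
  assumes "rank A + 1 = CARD('n)"
  obtains k where "k \<noteq> 0" "\<And>x. A *v x = 0 \<longleftrightarrow> (\<exists>c. x = c *\<^sub>R k)"
proof -
  have sub: "subspace {x. A *v x = 0}"
    by (simp add: subspace_def algebra_simps)
  have "dim {x. A *v x = 0} = 1"
    using rank_nullity[of A] assms by simp
  moreover obtain S where S: "S \<subseteq> {x. A *v x = 0}" "independent S" "{x. A *v x = 0} \<subseteq> span S"
      "card S = dim {x. A *v x = 0}"
    by (rule basis_exists)
  ultimately obtain k where k: "S = {k}"
    by (auto simp: card_1_singleton_iff)
  have "{x. A *v x = 0} = span {k}"
    using S k sub by (metis span_minimal subset_antisym)
  with S(2) k that[of k] show ?thesis
    by (auto simp: span_singleton set_eq_iff dependent_single)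
qed

text \<open>A linear right inverse of \<open>B\<close> on its range gives \<open>Y\<close> with
  \<open>B ** Y ** B = B\<close>; passing to \<open>Y ** B ** Y\<close> secures the second identity
  as well.\<close>

lemma matrix_reflexive_inverse_exists:
  fixes B :: "real^'k^'m"
  obtains X where "B ** X ** B = B" "X ** B ** X = X"
proof -
  obtain g where g: "linear g" "\<And>v. v \<in> range ((*v) B) \<Longrightarrow> B *v g v = v"
    using real_vector.linear_exists_right_inverse_on[of "(*v) B" UNIV] by auto
  define Y where "Y = matrix g"
  have Y: "Y *v v = g v" for v
    using g by (simp add: Y_def)
  have 1: "B ** Y ** B = B"
    by (simp add: matrix_eq g(2) Y flip: matrix_vector_mul_assoc)
  show ?thesis
    using that[of "Y ** B ** Y"] 1 by (metis matrix_mul_assoc)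
qed

text \<open>\<open>E\<close> spans an isotropic space for \<open>M\<close>. For a generalized inverse \<open>X\<close> of \<open>B = M E\<close>, the columns of
  \<open>E\<close> and \<open>Q = X\<^sup>T\<close> together with the kernel of \<open>M\<close> span everything, and subtracting half of the Gram matrix
  \<open>S = Q\<^sup>T M Q\<close> makes the dual factor isotropic as well.\<close>

lemma isotropic_decomposition:
  fixes M :: "real^'m^'m" and E :: "real^'k^'m"
  assumes sym: "transpose M = M"
    and iso: "transpose E ** (M ** E) = 0"
    and rk: "rank M = 2 * rank (M ** E)"
  obtains A where "M = A ** transpose (M ** E) + (M ** E) ** transpose A"
proof -
  define B where "B = M ** E"
  obtain X where X: "B ** X ** B = B" "X ** B ** X = X"
    by (rule matrix_reflexive_inverse_exists)
  define Q N where "Q = transpose X" and "N = X ** B"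
  define S where "S = X ** M ** Q"
  define A where "A = M ** Q - (1/2) *\<^sub>R (B ** S)"
  have NN: "N ** N = N" and BN: "B ** N = B" and NX: "N ** X = X"
    using X by (simp_all add: N_def matrix_mul_assoc)
  have Bt: "transpose B = transpose E ** M"
    by (simp add: B_def matrix_transpose_mul sym)
  have tN: "transpose N = transpose B ** Q"
    by (simp add: N_def Q_def matrix_transpose_mul)
  have tNN: "transpose N ** transpose N = transpose N"
    by (metis NN matrix_transpose_mul)
  have QN: "Q ** transpose N = Q"
    using NX by (metis Q_def matrix_transpose_mul)
  have SN: "S ** transpose N = S"
    by (simp add: S_def QN flip: matrix_mul_assoc)
  have tS: "transpose S = S"
    by (simp add: S_def Q_def matrix_transpose_mul sym matrix_mul_assoc)
  have Av: "A *v u = M *v (Q *v u) - (1/2) *\<^sub>R (B *v (S *v u))" for u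
    by (simp add: A_def algebra_simps matrix_vector_mul_assoc scaleR_matrix_vector_assoc)
  have "transpose A = X ** M - (1/2) *\<^sub>R (S ** transpose B)"
    by (simp add: A_def transpose_diff matrix_transpose_mul sym tS transpose_scalar Q_def)
  then have Atv: "transpose A *v w = X *v (M *v w) - (1/2) *\<^sub>R (S *v (transpose B *v w))" for w
    by (simp add: matrix_vector_mult_diff_rdistrib matrix_vector_mul_assoc scaleR_matrix_vector_assoc)
  \<comment> \<open>\<open>G\<close> is the defect of the claimed identity. It kills the columns of
    \<open>E\<close>, the columns of \<open>Q\<close> and the kernel of \<open>M\<close>; the
    dimension count below shows that these span everything.\<close>
  define G where "G = M - (A ** transpose B + B ** transpose A)"
  have G: "G *v v = M *v v - A *v (transpose B *v v) - B *v (transpose A *v v)" for v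
    by (simp add: G_def algebra_simps matrix_vector_mul_assoc)
  have tBE: "transpose B *v (E *v u) = 0" for u
    using iso by (simp add: Bt matrix_vector_mul_assoc flip: matrix_mul_assoc)
  have GE: "G *v (E *v u) = 0" for u
    by (simp add: G tBE Atv) (metis B_def BN N_def matrix_vector_mul_assoc right_minus_eq)
  have GQ: "G *v (Q *v u) = 0" for u
  proof -
    have 1: "transpose B *v (Q *v u) = transpose N *v u"
      by (simp add: tN matrix_vector_mul_assoc)
    have SN': "S *v (transpose N *v u) = S *v u"
      by (simp add: matrix_vector_mul_assoc SN)
    have "X *v (M *v (Q *v u)) = S *v u"
      by (simp add: S_def matrix_vector_mul_assoc matrix_mul_assoc)
    then have 2: "transpose A *v (Q *v u) = (1/2) *\<^sub>R (S *v u)"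
      using scaleR_half_double[of "S *v u"] by (simp add: Atv 1 SN' algebra_simps flip: scaleR_left_distrib)
    have 3: "A *v (transpose N *v u) = A *v u"
      unfolding Av by (simp add: matrix_vector_mul_assoc SN QN flip: matrix_mul_assoc)
    show ?thesis
      unfolding G 1 2 3 by (simp add: Av algebra_simps)
  qed
  have GM: "G *v v = 0" if "M *v v = 0" for v
    using that by (simp add: G Atv Bt flip: matrix_vector_mul_assoc)
  \<comment> \<open>The image of \<open>f\<close> on \<open>T\<close> consists of vectors
    \<open>M *v (E *v u + Q *v n)\<close>. Injectivity of \<open>f\<close> on \<open>T\<close> makes
    it large enough to be the whole range of \<open>M\<close>.\<close>
  define T where "T = range ((*v) B) \<times> range ((*v) (transpose N))"
  define f where "f = (\<lambda>p. fst p + M *v (Q *v snd p))"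
  have lin: "linear f"
    unfolding f_def by (rule linearI) (simp_all add: algebra_simps)
  have T: "subspace T"
    unfolding T_def by (intro subspace_Times linear_subspace_image) auto
  have "inj_on f T"
    unfolding linear_injective_on_subspace_0[OF lin T]
  proof (intro ballI impI)
    fix p assume "p \<in> T" "f p = 0"
    then obtain b n where p: "p = (B *v b, transpose N *v n)"
      and *: "B *v b + M *v (Q *v (transpose N *v n)) = 0"
      by (auto simp: T_def f_def)
    \<comment> \<open>Applying \<open>transpose E\<close> separates the two summands: isotropy
      annihilates the first, and the second reproduces its parameter because
      \<open>transpose N\<close> is idempotent.\<close>
    have "transpose E *v (B *v b) = 0"
      using iso by (simp add: B_def matrix_vector_mul_assoc matrix_mul_assoc)
    moreover have "transpose E *v (M *v (Q *v (transpose N *v n))) = transpose N *v n"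
      using tN tNN Bt by (simp add: matrix_vector_mul_assoc matrix_mul_assoc)
    ultimately have "transpose N *v n = 0"
      using arg_cong[OF *, of "(*v) (transpose E)"] by (simp add: matrix_vector_right_distrib)
    with * show "p = 0" by (simp add: p zero_prod_def)
  qed
  then have "dim (f ` T) = rank B + rank N"
    using dim_image_eq[OF lin, of T] T
    by (simp add: span_eq_iff[THEN iffD2] T_def dim_Times linear_subspace_image flip: rank_dim_range)
       (simp add: rank_transpose)
  \<comment> \<open>From \<open>B = B ** N\<close> the rank of \<open>N\<close> is at least that of
    \<open>B\<close>, and the rank of \<open>M\<close> is twice the rank of
    \<open>B\<close>.\<close>
  also have "\<dots> \<ge> rank M"
    using rank_mul_le_right[of B N] by (simp add: BN rk flip: B_def)
  finally have dim: "rank M \<le> dim (f ` T)" .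
  have "f ` T \<subseteq> range ((*v) M)"
  proof clarsimp
    fix b n assume "(b, n) \<in> T"
    then obtain u where "b = M *v (E *v u)"
      by (auto simp: T_def B_def matrix_vector_mul_assoc)
    then show "f (b, n) \<in> range ((*v) M)"
      by (simp add: f_def flip: matrix_vector_right_distrib)
  qed
  with dim have fT: "f ` T = range ((*v) M)"
    by (intro subspace_dim_equal) (auto simp: rank_dim_range intro!: linear_subspace_image lin T)
  have "G *v v = 0" for v
  proof -
    obtain u n where "M *v v = B *v u + M *v (Q *v n)"
      using fT unfolding T_def f_def
      by (smt (verit) SigmaE fst_conv imageE rangeI snd_conv)
    then have "M *v (v - E *v u - Q *v n) = 0"
      by (simp add: algebra_simps B_def matrix_vector_mul_assoc)
    from GM[OF this] show ?thesis
      by (simp add: algebra_simps GE GQ)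
  qed
  then have "G = 0"
    by (simp add: matrix_eq)
  then show ?thesis
    using that[of A] by (simp add: G_def B_def)
qed

subsection \<open>Skew-symmetric matrices\<close>

unbundle cross3_syntax

definition skew :: "real^3 \<Rightarrow> real^3^3" where
  "skew v = matrix (cross3 v)"

lemma skew_mult [simp]: "skew v *v x = v \<times> x"
proof -
  have lin: "linear (cross3 v)"
    using bilinear_cross unfolding bilinear_def by blast
  show ?thesis
    using fun_cong[OF matrix_vector_mul(2)[OF lin], of x] by (simp add: skew_def)
qed

lemma transpose_minus: "transpose (- A) = - transpose A"
  for A :: "'a::ring_1^'n^'m"
  by (simp add: transpose_def vec_eq_iff)

lemma transpose_add: "transpose (A + B) = transpose A + transpose B"
  for A B :: "'a::ring_1^'n^'m"
  by (simp add: transpose_def vec_eq_iff)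

lemma skew_diff: "skew (u - v) = skew u - skew v"
  by (simp add: matrix_eq algebra_simps Cross3.left_diff_distrib)

lemma skew_scaleR: "skew (c *\<^sub>R v) = c *\<^sub>R skew v"
  by (simp add: matrix_eq cross_mult_left flip: scaleR_matrix_vector_assoc)

lemma transpose_skew: "transpose (skew v) = - skew v"
  by (simp add: skew_def matrix_def transpose_def vec_eq_iff forall_3 cross_components axis_def)

lemma antisymmetric_imp_skew:
  fixes K :: "real^3^3"
  assumes "transpose K = - K"
  obtains k where "K = skew k"
proof
  have anti: "K $ i $ j = - K $ j $ i" for i j
  proof -
    have "transpose K $ j $ i = - K $ j $ i"
      using assms by simp
    then show ?thesis
      by (simp add: transpose_def)
  qed
  have "K$1$1 = 0" "K$2$2 = 0" "K$3$3 = 0"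
    using anti[of 1 1] anti[of 2 2] anti[of 3 3] by linarith+
  with anti[of 1 2] anti[of 2 3] anti[of 3 1]
  show "K = skew (vector [K$3$2, K$1$3, K$2$1])"
    by (simp add: skew_def matrix_def axis_def vec_eq_iff forall_3 cross_components)
qed

lemma cross_eq_0_imp_parallel:
  assumes "u \<times> v = 0" "u \<noteq> 0"
  obtains c where "v = c *\<^sub>R u"
proof (cases "v = 0")
  case True
  then show ?thesis using that[of 0] by simp
next
  case False
  then show ?thesis
    using assms that unfolding cross_eq_0 collinear_lemma by blast
qed

text \<open>\<open>F *v y\<close> and \<open>G *v y\<close> have the same orthogonal complement,
  hence are parallel; comparing the factors at \<open>y\<close>, \<open>y0\<close> and
  \<open>y + y0\<close> shows that the factor is constant. Thus \<open>psi\<close> can be identified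
  up to scale from its zeros, without expanding a determinant.\<close>

lemma bilinear_forms_same_zeros:
  fixes F G :: "real^'n^'m"
  assumes zeros: "\<And>x y. x \<bullet> (F *v y) = 0 \<longleftrightarrow> x \<bullet> (G *v y) = 0"
  obtains c where "c \<noteq> 0" "F = c *\<^sub>R G"
proof -
  have 0: "F *v y = 0 \<longleftrightarrow> G *v y = 0" for y
    using zeros[of "F *v y" y] zeros[of "G *v y" y] by auto
  have par: "\<exists>c. F *v y = c *\<^sub>R (G *v y)" for y
  proof (cases "G *v y = 0")
    case False
    define c where "c = ((F *v y) \<bullet> (G *v y)) / ((G *v y) \<bullet> (G *v y))"
    define x where "x = F *v y - c *\<^sub>R (G *v y)"
    have "x \<bullet> (G *v y) = 0"
      using False by (simp add: x_def c_def inner_diff_left)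
    moreover from this have "x \<bullet> (F *v y) = 0"
      by (simp add: zeros)
    ultimately have "x \<bullet> x = 0"
      by (subst (2) x_def) (simp add: inner_diff_right)
    then show ?thesis
      by (auto simp: x_def)
  qed (simp add: 0)
  show ?thesis
  proof (cases "G = 0")
    case True
    with 0 have "F = 0" by (simp add: matrix_eq)
    with True that[of 1] show ?thesis by simp
  next
    case False
    then obtain y0 where y0: "G *v y0 \<noteq> 0" by (auto simp: matrix_eq)
    obtain c where c: "F *v y0 = c *\<^sub>R (G *v y0)" using par by blast
    have "F *v y = c *\<^sub>R (G *v y)" for y
    proof (cases "\<exists>b. G *v y = b *\<^sub>R (G *v y0)")
      case True
      then obtain b where b: "G *v y = b *\<^sub>R (G *v y0)" by blast
      then have "G *v (y - b *\<^sub>R y0) = 0"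
        by (simp add: algebra_simps)
      then have "F *v (y - b *\<^sub>R y0) = 0"
        by (simp add: 0)
      with b c show ?thesis
        by (simp add: algebra_simps)
    next
      case nex: False
      obtain a where a: "F *v y = a *\<^sub>R (G *v y)" using par by blast
      obtain d where d: "F *v (y + y0) = d *\<^sub>R (G *v (y + y0))" using par by blast
      have *: "(a - d) *\<^sub>R (G *v y) = (d - c) *\<^sub>R (G *v y0)"
        using a c d by (simp add: algebra_simps)
      have "a = d"
      proof (rule ccontr)
        assume "a \<noteq> d"
        then have "G *v y = ((d - c) / (a - d)) *\<^sub>R (G *v y0)"
          using arg_cong[OF *, of "\<lambda>v. (1 / (a - d)) *\<^sub>R v"] by simp
        with nex show False by blast
      qed
      with * y0 a show ?thesis by simp
    qed
    then have "F = c *\<^sub>R G"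
      by (simp add: matrix_eq flip: scaleR_matrix_vector_assoc)
    moreover have "c \<noteq> 0" using 0[of y0] c y0 by auto
    ultimately show ?thesis using that by blast
  qed
qed

subsection \<open>The bilinear form of two cameras\<close>

lemma det_eq_0_iff_kernel:
  fixes A :: "real^'n^'n"
  shows "det A = 0 \<longleftrightarrow> (\<exists>z. z \<noteq> 0 \<and> A *v z = 0)"
  using rank_bound[of A] by (simp add: matrix_nonfull_linear_equations_eq det_eq_0_rank nat_less_le)

lemma sum_6: "sum f (UNIV::6 set) = f 1 + f 2 + f 3 + f 4 + f 5 + f 6"
proof -
  have U: "(UNIV::6 set) = {1, 2, 3, 4, 5, 6}"
    using nat6_cases by auto
  show ?thesis
    unfolding U by (simp add: add.assoc)
qed

lemma vector_4:
  "(vector [a,b,c,d] :: 'a::zero^4) $ 1 = a"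
  "(vector [a,b,c,d] :: 'a::zero^4) $ 2 = b"
  "(vector [a,b,c,d] :: 'a::zero^4) $ 3 = c"
  "(vector [a,b,c,d] :: 'a::zero^4) $ 4 = d"
  unfolding vector_def by simp_all

lemma joint_matrix_mult_eq_0:
  "joint_matrix P Q x y *v z = 0 \<longleftrightarrow>
    P *v vector [z$1, z$2, z$3, z$4] + (z$5) *\<^sub>R x = 0 \<and>
    Q *v vector [z$1, z$2, z$3, z$4] + (z$6) *\<^sub>R y = 0"
  unfolding vec_eq_iff all_6 forall_3 matrix_vector_mult_def sum_6 sum_4 joint_matrix_def
  by (simp add: vector_6 vector_4 mult.commute)

text \<open>The determinant vanishes exactly when the joint matrix has a nonzero kernel vector,
  which splits into a space vector \<open>X\<close> and two scalars. Generically this says that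
  \<open>x\<close> and \<open>y\<close> are images of a common point.\<close>

lemma psi_eq_0_iff:
  "x \<bullet> (psi P Q *v y) = 0 \<longleftrightarrow>
    (\<exists>X a b. (X, a, b) \<noteq> 0 \<and> P *v X + a *\<^sub>R x = 0 \<and> Q *v X + b *\<^sub>R y = 0)"
proof -
  have "x \<bullet> (psi P Q *v y) = 0 \<longleftrightarrow> (\<exists>z. z \<noteq> 0 \<and> joint_matrix P Q x y *v z = 0)"
    by (simp only: det_joint_matrix[symmetric] det_eq_0_iff_kernel)
  also have "\<dots> \<longleftrightarrow> (\<exists>X a b. (X, a, b) \<noteq> 0 \<and> P *v X + a *\<^sub>R x = 0 \<and> Q *v X + b *\<^sub>R y = 0)" (is "?l = ?r")
  proof
    assume ?l
    then obtain z where z: "z \<noteq> 0" "joint_matrix P Q x y *v z = 0" by blast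
    from z(1) have "(vector [z$1, z$2, z$3, z$4] :: real^4, z$5, z$6) \<noteq> 0"
      by (auto simp: vec_eq_iff all_6 forall_4 zero_prod_def vector_4)
    with z(2) show ?r
      unfolding joint_matrix_mult_eq_0 by blast
  next
    assume ?r
    then obtain X a b where *: "(X, a, b) \<noteq> 0" "P *v X + a *\<^sub>R x = 0" "Q *v X + b *\<^sub>R y = 0" by blast
    define z where "z = (vector [X$1, X$2, X$3, X$4, a, b] :: real^6)"
    have X: "vector [z$1, z$2, z$3, z$4] = X" and z: "z$5 = a" "z$6 = b"
      by (auto simp: z_def vector_6 vector_4 vec_eq_iff forall_4)
    have "joint_matrix P Q x y *v z = 0"
      using * by (simp add: joint_matrix_mult_eq_0 X z)
    moreover have "z \<noteq> 0"
    proof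
      assume "z = 0"
      then have "X = 0" "a = 0" "b = 0"
        using z by (simp_all add: X[symmetric] vec_eq_iff forall_4 vector_4)
      with *(1) show False by (simp add: zero_prod_def)
    qed
    ultimately show ?l by blast
  qed
  finally show ?thesis .
qed

text \<open>The triple product is the determinant with rows \<open>x\<close>, \<open>d\<close>,
  \<open>y\<close>, so it vanishes exactly when the three vectors are dependent.\<close>

lemma triple_product_eq_0_iff:
  "x \<bullet> (d \<times> y) = 0 \<longleftrightarrow> (\<exists>s a b. (s, a, b) \<noteq> 0 \<and> s *\<^sub>R d + a *\<^sub>R x + b *\<^sub>R y = 0)"
proof -
  define A where "A = transpose (vector [x, d, y] :: real^3^3)"
  have A: "A *v z = (z$2) *\<^sub>R d + (z$1) *\<^sub>R x + (z$3) *\<^sub>R y" for z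
    by (simp add: A_def matrix_vector_column sum_3 scalar_mult_eq_scaleR vector_3)
  have "x \<bullet> (d \<times> y) = 0 \<longleftrightarrow> (\<exists>z. z \<noteq> 0 \<and> A *v z = 0)"
    by (simp only: dot_cross_det A_def det_transpose[symmetric, of "vector _"] det_eq_0_iff_kernel)
  also have "\<dots> \<longleftrightarrow> (\<exists>s a b. (s, a, b) \<noteq> 0 \<and> s *\<^sub>R d + a *\<^sub>R x + b *\<^sub>R y = 0)" (is "?l = ?r")
  proof
    assume ?l
    then obtain z where z: "z \<noteq> 0" "A *v z = 0" by blast
    from z(1) have "(z$2, z$1, z$3) \<noteq> 0"
      by (auto simp: vec_eq_iff forall_3 zero_prod_def)
    with z(2) show ?r
      unfolding A by blast
  next
    assume ?r
    then obtain s a b where *: "(s, a, b) \<noteq> 0" "s *\<^sub>R d + a *\<^sub>R x + b *\<^sub>R y = 0" by blast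
    then have "A *v vector [a, s, b] = 0" "(vector [a, s, b] :: real^3) \<noteq> 0"
      by (auto simp: A vector_3 zero_prod_def vec_eq_iff[of "vector _"] forall_3)
    then show ?l by blast
  qed
  finally show ?thesis .
qed

text \<open>Only zeros have to be compared. Since \<open>transpose V\<close> inverts
  \<open>M\<close> and \<open>transpose W\<close> inverts \<open>N\<close>, both camera equations
  can be solved for \<open>v\<close>; subtracting them eliminates \<open>v\<close> and leaves a
  linear dependency of \<open>t - u\<close> and the two viewing directions, that is, a vanishing
  triple product.\<close>

lemma psi_affine_cameras:
  fixes h :: "(real^3) \<times> real \<Rightarrow> real^4"
  assumes h: "linear h" "bij h"
    and P: "\<And>v s. P *v h (v, s) = M *v (v - s *\<^sub>R t)" "transpose V ** M = mat 1"
    and Q: "\<And>v s. Q *v h (v, s) = N *v (v - s *\<^sub>R u)" "transpose W ** N = mat 1"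
  obtains c where "c \<noteq> 0" "psi P Q = c *\<^sub>R (V ** skew (t - u) ** transpose W)"
proof (rule bilinear_forms_same_zeros)
  fix x y
  have solve: "A *v v + a *\<^sub>R z = 0 \<longleftrightarrow> v + a *\<^sub>R (transpose B *v z) = 0"
    if "transpose B ** A = mat 1" for A B :: "real^3^3" and v z a
  proof -
    have 1: "transpose B *v (A *v v) = v" for v
      by (simp add: that matrix_vector_mul_assoc)
    have 2: "A *v (transpose B *v v) = v" for v
      using that by (simp add: matrix_left_right_inverse matrix_vector_mul_assoc)
    show ?thesis
      using 1 2 by (metis matrix_vector_mult_0_right matrix_vector_mult_scaleR matrix_vector_right_distrib)
  qed
  have "x \<bullet> (psi P Q *v y) = 0 \<longleftrightarrow>
      (\<exists>p a b. (h p, a, b) \<noteq> 0 \<and> P *v h p + a *\<^sub>R x = 0 \<and> Q *v h p + b *\<^sub>R y = 0)"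
    unfolding psi_eq_0_iff by (metis bij_pointE[OF h(2)])
  also have "\<dots> \<longleftrightarrow> (\<exists>v s a b. (v, s, a, b) \<noteq> 0 \<and> M *v (v - s *\<^sub>R t) + a *\<^sub>R x = 0
      \<and> N *v (v - s *\<^sub>R u) + b *\<^sub>R y = 0)"
    using linear_injective_0[OF h(1)] linear_0[OF h(1)] bij_is_inj[OF h(2)]
    by (simp add: split_paired_Ex zero_prod_def P Q) metis
  also have "\<dots> \<longleftrightarrow> (\<exists>v s a b. (v, s, a, b) \<noteq> 0 \<and> (v - s *\<^sub>R t) + a *\<^sub>R (transpose V *v x) = 0
      \<and> (v - s *\<^sub>R u) + b *\<^sub>R (transpose W *v y) = 0)"
    using P(2) Q(2) by (simp add: solve)
  also have "\<dots> \<longleftrightarrow> (\<exists>s a b. (s, a, b) \<noteq> 0 \<and>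
      s *\<^sub>R (t - u) + a *\<^sub>R (transpose V *v x) + b *\<^sub>R (transpose W *v y) = 0)" (is "?l = ?r")
  proof
    assume ?l
    then obtain v s a b where *: "(v, s, a, b) \<noteq> 0" "(v - s *\<^sub>R t) + a *\<^sub>R (transpose V *v x) = 0"
      "(v - s *\<^sub>R u) + b *\<^sub>R (transpose W *v y) = 0" by blast
    have "(s, - a, b) \<noteq> 0"
      using * by (auto simp: zero_prod_def)
    moreover have "s *\<^sub>R (t - u) + (- a) *\<^sub>R (transpose V *v x) + b *\<^sub>R (transpose W *v y) =
        ((v - s *\<^sub>R u) + b *\<^sub>R (transpose W *v y)) - ((v - s *\<^sub>R t) + a *\<^sub>R (transpose V *v x))"
      by (simp add: algebra_simps)
    ultimately show ?r using * by (metis diff_zero)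
  next
    assume ?r
    then obtain s a b where *: "(s, a, b) \<noteq> 0"
      "s *\<^sub>R (t - u) + a *\<^sub>R (transpose V *v x) + b *\<^sub>R (transpose W *v y) = 0" by blast
    define v where "v = s *\<^sub>R t + a *\<^sub>R (transpose V *v x)"
    have "(v, s, - a, b) \<noteq> 0" using * by (auto simp: zero_prod_def)
    moreover have "(v - s *\<^sub>R t) + (- a) *\<^sub>R (transpose V *v x) = 0"
      by (simp add: v_def)
    moreover have "(v - s *\<^sub>R u) + b *\<^sub>R (transpose W *v y) = 0"
      using * by (simp add: v_def algebra_simps)
    ultimately show ?l by blast
  qed
  also have "\<dots> \<longleftrightarrow> x \<bullet> (V ** skew (t - u) ** transpose W *v y) = 0"
    unfolding triple_product_eq_0_iff[symmetric]
    by (simp add: inner_matrix_transpose[of x V] flip: matrix_vector_mul_assoc)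
  finally show "x \<bullet> (psi P Q *v y) = 0 \<longleftrightarrow> x \<bullet> (V ** skew (t - u) ** transpose W *v y) = 0" .
qed

subsection \<open>Cameras in an affine chart\<close>

lemma dim_span_pair:
  assumes "\<And>a b. a *\<^sub>R x + b *\<^sub>R y = 0 \<Longrightarrow> a = 0 \<and> b = 0"
  shows "dim (span {x, y}) = 2"
proof -
  have xy: "x \<noteq> y"
    using assms[of 1 "-1"] by auto
  have "y \<noteq> 0"
    using assms[of 0 1] by auto
  moreover have "x \<notin> span {y}"
  proof
    assume "x \<in> span {y}"
    then obtain c where "x = c *\<^sub>R y" by (auto simp: span_singleton)
    with assms[of 1 "-c"] show False by simp
  qed
  ultimately have "independent {x, y}"
    using xy by (simp add: independent_insert)
  then show ?thesis
    using xy by (simp add: dim_eq_card_independent)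
qed

text \<open>The chart is \<open>h (v, s) = g v + s *\<^sub>R w\<close> with an isomorphism
  \<open>g\<close> onto the orthogonal complement of \<open>w\<close>. That complement becomes the
  plane at infinity \<open>s = 0\<close>.\<close>

lemma hyperplane_chart_exists:
  fixes w :: "real^4"
  assumes "w \<noteq> 0"
  obtains h :: "(real^3) \<times> real \<Rightarrow> real^4" where "linear h" "bij h" "\<And>v. w \<bullet> h (v, 0) = 0"
proof -
  have "dim {x. w \<bullet> x = 0} = 3"
    using assms by (simp add: dim_hyperplane)
  then obtain g :: "real^3 \<Rightarrow> real^4" where g: "linear g" "range g = {x. w \<bullet> x = 0}" "inj g"
    using subspace_isomorphism[of "UNIV :: (real^3) set" "{x. w \<bullet> x = 0}"]
    by (auto simp: subspace_hyperplane)
  define h where "h = (\<lambda>p. g (fst p) + snd p *\<^sub>R w)"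
  have lin: "linear h"
    unfolding h_def using g(1)
    by (intro linear_compose_add linear_compose[OF linear_fst, unfolded o_def])
       (auto intro!: linearI simp: linear_add linear_scale algebra_simps)
  have wg: "w \<bullet> g v = 0" for v
    using g(2) by blast
  have "inj h"
    unfolding linear_injective_0[OF lin]
  proof (intro allI impI)
    fix p assume p: "h p = 0"
    have "w \<bullet> h p = snd p * (w \<bullet> w)"
      by (simp add: h_def inner_add_right wg)
    with p assms have "snd p = 0" by simp
    moreover from this p have "g (fst p) = 0" by (simp add: h_def)
    then have "fst p = 0"
      using g(1,3) by (simp add: linear_injective_0)
    ultimately show "p = 0" by (simp add: prod_eq_iff)
  qed
  moreover have "surj h"
    unfolding surj_def
  proof
    fix x
    define s where "s = (w \<bullet> x) / (w \<bullet> w)"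
    have "w \<bullet> (x - s *\<^sub>R w) = 0"
      using assms by (simp add: s_def inner_diff_right)
    then obtain v where "x - s *\<^sub>R w = g v"
      using g(2) by blast
    then have "x = h (v, s)"
      by (simp add: h_def algebra_simps)
    then show "\<exists>p. x = h p" by blast
  qed
  ultimately have "bij h" by (simp add: bij_def)
  then show ?thesis
    using that[of h] lin wg by (simp add: h_def)
qed

text \<open>A finite union of hyperplanes has measure zero. This supplies both a plane missing all
  centers and a generic shift \<open>z\<close>.\<close>

lemma exists_avoiding_hyperplanes:
  fixes a :: "'n::finite \<Rightarrow> 'a::euclidean_space"
  assumes "\<And>i. i \<in> I \<Longrightarrow> a i \<noteq> 0"
  obtains z where "\<And>i. i \<in> I \<Longrightarrow> a i \<bullet> z \<noteq> b i"
proof -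
  have "negligible (\<Union>i\<in>I. {x. a i \<bullet> x = b i})"
    using assms by (intro negligible_Union) (auto intro: negligible_hyperplane)
  then have "(\<Union>i\<in>I. {x. a i \<bullet> x = b i}) \<noteq> UNIV"
    by (metis non_negligible_UNIV)
  then show ?thesis
    using that by blast
qed

text \<open>The data of cameras \<open>M [I | -t]\<close> in a chart: \<open>t i\<close> is the
  affine center and \<open>V i\<close> is the inverse transpose of the left block
  \<open>M\<close>.\<close>

definition affine_solution ::
    "('n \<Rightarrow> 'n \<Rightarrow> real^3^3) \<Rightarrow> ('n \<Rightarrow> real^3^3) \<Rightarrow> ('n \<Rightarrow> real^3) \<Rightarrow> bool" where
  "affine_solution F V t \<longleftrightarrow> (\<forall>i. invertible (V i)) \<and>
     (\<forall>i j. i \<noteq> j \<longrightarrow> (\<exists>c. c \<noteq> 0 \<and> F i j = c *\<^sub>R (V i ** skew (t i - t j) ** transpose (V j))))"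

section \<open>Cameras \<open>M [I | -t]\<close> in a fixed chart\<close>

context
  fixes h :: "(real^3) \<times> real \<Rightarrow> real^4"
    and P :: "'n \<Rightarrow> real^4^3" and M V :: "'n \<Rightarrow> real^3^3" and t :: "'n \<Rightarrow> real^3"
  assumes h: "linear h" "bij h"
    and P: "\<And>i v s. P i *v h (v, s) = M i *v (v - s *\<^sub>R t i)"
    and VM: "\<And>i. transpose (V i) ** M i = mat 1"
begin

lemma chart_is_camera: "is_camera (P i)"
proof -
  have "M i ** transpose (V i) = mat 1"
    using VM by (simp add: matrix_left_right_inverse)
  then have "y = P i *v h (transpose (V i) *v y, 0)" for y
    by (simp add: P matrix_vector_mul_assoc)
  then have "surj ((*v) (P i))"
    unfolding surj_def by blast
  then show ?thesis
    unfolding is_camera_def using full_rank_surjective[of "P i"] by simp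
qed

lemma chart_center: "center (P i) = span {h (t i, 1)}"
proof -
  have inj: "M i *v v = 0 \<longleftrightarrow> v = 0" for v
    using VM[of i] by (metis matrix_vector_mul_assoc matrix_vector_mul_lid matrix_vector_mult_0_right)
  have "P i *v X = 0 \<longleftrightarrow> (\<exists>c. X = c *\<^sub>R h (t i, 1))" for X
  proof -
    obtain v s where X: "X = h (v, s)"
      using h(2) by (metis bij_pointE surj_pair)
    have "c *\<^sub>R h (t i, 1) = h (c *\<^sub>R t i, c)" for c
      using linear_scale[OF h(1), of c "(t i, 1)"] by simp
    then show ?thesis
      using bij_is_inj[OF h(2)] by (auto simp: X P inj inj_eq)
  qed
  then show ?thesis
    by (auto simp: center_def null_sp_def span_singleton)
qed

text \<open>In homogeneous coordinates the affine line through \<open>u\<close> in direction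
  \<open>d\<close> is cut out of the plane spanned by \<open>h (u, 1)\<close> and
  \<open>h (d, 0)\<close>. Conversely, two distinct centers span \<open>L\<close>, and comparing
  last coordinates turns linear combinations into affine ones.\<close>

lemma chart_collinear: "proj_collinear (range (\<lambda>i. center (P i))) \<longleftrightarrow> collinear (range t)"
proof
  assume "collinear (range t)"
  then obtain u d0 where "\<forall>i. \<exists>c. t i = u + c *\<^sub>R d0"
    by (auto simp: collinear_alt)
  \<comment> \<open>If all centers coincide, \<open>d0\<close> may be zero; any nonzero direction
    then gives a line through them.\<close>
  then obtain d where d: "d \<noteq> 0" "\<And>i. \<exists>c. t i = u + c *\<^sub>R d"
    by (cases "d0 = 0") (use axis_nth[of 1 1] in \<open>force intro: that[of "axis 1 1"]\<close>, blast)
  define L where "L = span {h (u, 1), h (d, 0)}"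
  have "a *\<^sub>R h (u, 1) + b *\<^sub>R h (d, 0) = h (a *\<^sub>R u + b *\<^sub>R d, a)" for a b
    by (simp flip: linear_scale[OF h(1)] linear_add[OF h(1)])
  note comb = this
  have "dim L = 2"
    unfolding L_def
  proof (rule dim_span_pair)
    fix a b assume "a *\<^sub>R h (u, 1) + b *\<^sub>R h (d, 0) = 0"
    then have "(a *\<^sub>R u + b *\<^sub>R d, a) = 0"
      using linear_injective_0[OF h(1)] bij_is_inj[OF h(2)] by (simp add: comb)
    with d(1) show "a = 0 \<and> b = 0" by (auto simp: zero_prod_def)
  qed
  moreover have "center (P i) \<subseteq> L" for i
  proof -
    obtain c where "t i = u + c *\<^sub>R d" using d(2) by blast
    then have "h (t i, 1) = 1 *\<^sub>R h (u, 1) + c *\<^sub>R h (d, 0)"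
      by (simp only: comb) simp
    then have "h (t i, 1) \<in> L"
      unfolding L_def by (simp add: span_add span_base span_scale)
    then show ?thesis
      unfolding chart_center L_def by (simp add: span_minimal)
  qed
  ultimately show "proj_collinear (range (\<lambda>i. center (P i)))"
    unfolding proj_collinear_def L_def by (metis (no_types, lifting) imageE subspace_span)
next
  assume "proj_collinear (range (\<lambda>i. center (P i)))"
  then obtain L where L: "subspace L" "dim L = 2" "\<And>i. center (P i) \<subseteq> L"
    by (auto simp: proj_collinear_def)
  have hL: "h (t i, 1) \<in> L" for i
    using L(3)[of i] by (auto simp: chart_center span_base)
  show "collinear (range t)"
  proof (cases "\<exists>i j. t i \<noteq> t j")
    case True
    then obtain p q where pq: "t p \<noteq> t q" by blast
    have comb: "a *\<^sub>R h (t p, 1) + b *\<^sub>R h (t q, 1) = h (a *\<^sub>R t p + b *\<^sub>R t q, a + b)" for a b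
      by (simp flip: linear_scale[OF h(1)] linear_add[OF h(1)])
    have "dim (span {h (t p, 1), h (t q, 1)}) = 2"
    proof (rule dim_span_pair)
      fix a b assume "a *\<^sub>R h (t p, 1) + b *\<^sub>R h (t q, 1) = 0"
      then have *: "(a *\<^sub>R t p + b *\<^sub>R t q, a + b) = 0"
        using linear_injective_0[OF h(1)] bij_is_inj[OF h(2)] by (simp add: comb)
      then have b: "b = - a" by (simp add: zero_prod_def)
      with * have "a *\<^sub>R (t p - t q) = 0" by (simp add: zero_prod_def algebra_simps)
      with pq b show "a = 0 \<and> b = 0" by simp
    qed
    then have "span {h (t p, 1), h (t q, 1)} = L"
      using L hL by (intro subspace_dim_equal span_minimal) auto
    then have "\<exists>c. t i = t p + c *\<^sub>R (t q - t p)" for i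
    proof -
      have "h (t i, 1) \<in> span {h (t p, 1), h (t q, 1)}"
        using hL \<open>span _ = L\<close> by simp
      then obtain a b where "h (t i, 1) = a *\<^sub>R h (t p, 1) + b *\<^sub>R h (t q, 1)"
        by (auto simp: span_breakdown_eq span_singleton algebra_simps)
      then have "t i = a *\<^sub>R t p + b *\<^sub>R t q" "a = 1 - b"
        using bij_is_inj[OF h(2)] by (auto simp: comb inj_eq)
      then have "t i = t p + b *\<^sub>R (t q - t p)"
        by (simp add: algebra_simps)
      then show ?thesis by blast
    qed
    then show ?thesis
      unfolding collinear_alt by blast
  next
    case False
    then show ?thesis
      unfolding collinear_def by (auto intro: exI[of _ 0])
  qed
qed

lemma chart_solution_iff: "is_solution F P \<longleftrightarrow> affine_solution F V t"
proof -
  have inv: "invertible (V i)" for i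
    using VM[of i] transpose_invertible[of "transpose (V i)"]
    by (auto simp: invertible_right_inverse)
  have "(\<exists>c. c \<noteq> 0 \<and> F i j = c *\<^sub>R psi (P i) (P j)) \<longleftrightarrow>
      (\<exists>c. c \<noteq> 0 \<and> F i j = c *\<^sub>R (V i ** skew (t i - t j) ** transpose (V j)))" for i j
  proof -
    obtain c where c: "c \<noteq> 0" "psi (P i) (P j) = c *\<^sub>R (V i ** skew (t i - t j) ** transpose (V j))"
      using psi_affine_cameras[OF h P VM P VM] by metis
    show ?thesis
    proof
      assume "\<exists>a. a \<noteq> 0 \<and> F i j = a *\<^sub>R psi (P i) (P j)"
      then obtain a where "a \<noteq> 0" "F i j = a *\<^sub>R psi (P i) (P j)" by blast
      with c show "\<exists>a. a \<noteq> 0 \<and> F i j = a *\<^sub>R (V i ** skew (t i - t j) ** transpose (V j))"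
        by (intro exI[of _ "a * c"]) simp
    next
      assume "\<exists>a. a \<noteq> 0 \<and> F i j = a *\<^sub>R (V i ** skew (t i - t j) ** transpose (V j))"
      then obtain a where "a \<noteq> 0" "F i j = a *\<^sub>R (V i ** skew (t i - t j) ** transpose (V j))" by blast
      with c show "\<exists>a. a \<noteq> 0 \<and> F i j = a *\<^sub>R psi (P i) (P j)"
        by (intro exI[of _ "a / c"]) simp
    qed
  qed
  then show ?thesis
    unfolding is_solution_def affine_solution_def by (simp add: inv chart_is_camera)
qed

end

section \<open>Passage between camera solutions and affine data\<close>

lemma camera_kernel:
  assumes "is_camera P"
  obtains k where "k \<noteq> 0" "\<And>x. P *v x = 0 \<longleftrightarrow> (\<exists>c. x = c *\<^sub>R k)"
  using assms kernel_spanned[of P] by (auto simp: is_camera_def)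

text \<open>A plane that avoids the finitely many centers is sent to infinity, so that every center
  becomes finite and every left block invertible.\<close>

lemma solution_imp_affine:
  fixes F :: "'n::finite \<Rightarrow> 'n \<Rightarrow> real^3^3"
  assumes sol: "is_solution F P"
  obtains V t where "affine_solution F V t"
    "proj_collinear (range (\<lambda>i. center (P i))) \<longleftrightarrow> collinear (range t)"
proof -
  have "\<exists>k. k \<noteq> 0 \<and> (\<forall>x. P i *v x = 0 \<longleftrightarrow> (\<exists>c. x = c *\<^sub>R k))" for i
    using camera_kernel[of "P i"] sol unfolding is_solution_def by metis
  then obtain k where k: "\<And>i. k i \<noteq> 0" "\<And>i x. P i *v x = 0 \<longleftrightarrow> (\<exists>c. x = c *\<^sub>R k i)"
    by metis
  obtain w where w: "\<And>i. k i \<bullet> w \<noteq> 0"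
    using exists_avoiding_hyperplanes[of UNIV k "\<lambda>_. 0"] k(1) by auto
  then have "w \<noteq> 0" by auto
  then obtain h :: "(real^3) \<times> real \<Rightarrow> real^4"
    where h: "linear h" "bij h" "\<And>v. w \<bullet> h (v, 0) = 0"
    using hyperplane_chart_exists by blast
  define M where "M i = matrix (\<lambda>v. P i *v h (v, 0))" for i
  have lin: "linear (\<lambda>v. P i *v h (v, 0))" for i
  proof (rule linearI)
    fix x y :: "real^3" and r
    show "P i *v h (x + y, 0) = P i *v h (x, 0) + P i *v h (y, 0)"
      using linear_add[OF h(1), of "(x, 0)" "(y, 0)"] by (simp add: matrix_vector_right_distrib)
    show "P i *v h (r *\<^sub>R x, 0) = r *\<^sub>R (P i *v h (x, 0))"
      using linear_scale[OF h(1), of r "(x, 0)"] by (simp add: matrix_vector_mult_scaleR)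
  qed
  have M: "M i *v v = P i *v h (v, 0)" for i v
    using fun_cong[OF matrix_vector_mul(2)[OF lin]] by (simp add: M_def)
  have "inj ((*v) (M i))" for i
    unfolding linear_injective_0[OF matrix_vector_mul_linear]
  proof (intro allI impI)
    fix v assume "M i *v v = 0"
    \<comment> \<open>A kernel vector of \<open>M i\<close> would put the center \<open>k i\<close>
      into the plane orthogonal to \<open>w\<close>, unless it is zero.\<close>
    then obtain c where c: "h (v, 0) = c *\<^sub>R k i"
      by (auto simp: M k(2))
    then have "c * (k i \<bullet> w) = 0"
      using h(3)[of v] by (simp add: inner_commute)
    with c w have "h (v, 0) = 0" by simp
    then have "(v, 0::real) = 0"
      using linear_injective_0[OF h(1)] bij_is_inj[OF h(2)] by blast
    then show "v = 0" by (simp add: zero_prod_def)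
  qed
  then have "\<exists>W. W ** M i = mat 1" for i
    by (simp add: matrix_left_invertible_injective)
  then obtain W where W: "\<And>i. W i ** M i = mat 1" by metis
  \<comment> \<open>The center is to be \<open>h (t i, 1)\<close>, which forces
    \<open>M i *v t i\<close> to be minus the image of \<open>h (0, 1)\<close>.\<close>
  define t where "t i = - (W i *v (P i *v h (0, 1)))" for i
  have P: "P i *v h (v, s) = M i *v (v - s *\<^sub>R t i)" for i v s
  proof -
    have "M i *v (W i *v x) = x" for x
      using W[of i] by (simp add: matrix_vector_mul_assoc matrix_left_right_inverse)
    moreover have "h (v, s) = h (v, 0) + s *\<^sub>R h (0, 1)"
      using linear_add[OF h(1), of "(v, 0)" "(0, s)"] linear_scale[OF h(1), of s "(0, 1)"] by simp
    ultimately show ?thesis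
      by (simp add: t_def algebra_simps M)
  qed
  have VM: "transpose (transpose (W i)) ** M i = mat 1" for i
    by (simp add: W)
  show ?thesis
    using that[of "\<lambda>i. transpose (W i)" t] sol
      chart_solution_iff[where P = P and t = t, OF h(1,2) P VM]
      chart_collinear[where P = P and t = t, OF h(1,2) P VM] by blast
qed

text \<open>In any bijective linear chart the data prescribe the cameras \<open>M [I | -t]\<close>
  outright, so the chart of an arbitrary nonzero vector serves.\<close>

lemma affine_imp_solution:
  assumes sol: "affine_solution F V t"
  obtains P where "is_solution F P"
    "proj_collinear (range (\<lambda>i. center (P i))) \<longleftrightarrow> collinear (range t)"
proof -
  have "\<exists>M. transpose (V i) ** M = mat 1" for i
    using sol transpose_invertible[of "V i"] by (auto simp: affine_solution_def invertible_right_inverse)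
  then obtain M where M: "\<And>i. transpose (V i) ** M i = mat 1" by metis
  obtain h :: "(real^3) \<times> real \<Rightarrow> real^4" where h: "linear h" "bij h"
    using hyperplane_chart_exists[of "axis 1 1"] by (metis axis_eq_0_iff zero_neq_one)
  obtain g where g: "linear g" "\<And>p. g (h p) = p"
    using linear_injective_left_inverse[OF h(1) bij_is_inj[OF h(2)]] by (metis comp_apply id_apply)
  define f where "f i = (\<lambda>p. M i *v (fst p - snd p *\<^sub>R t i))" for i
  have "linear (f i)" for i
    by (rule linearI) (simp_all add: f_def algebra_simps)
  then have lin: "linear (f i \<circ> g)" for i
    using g(1) by (simp add: linear_compose)
  define P where "P i = matrix (f i \<circ> g)" for i
  have P: "P i *v h (v, s) = M i *v (v - s *\<^sub>R t i)" for i v s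
    using fun_cong[OF matrix_vector_mul(2)[OF lin]] by (simp add: P_def f_def g(2))
  show ?thesis
    using that[of P] sol chart_solution_iff[where P = P and t = t, OF h P M]
      chart_collinear[where P = P and t = t, OF h P M] by blast
qed

subsection \<open>Ranks of the block matrix of a solution\<close>

lemma uminus_matrix_vector_mult: "(- A) *v x = - (A *v x)"
  for A :: "'a::ring_1^'n^'m"
  by (simp add: vec_eq_iff matrix_vector_mult_def sum_negf)

definition blk :: "real^('n::finite \<times> 3) \<Rightarrow> 'n \<Rightarrow> real^3" where
  "blk x i = (\<chi> a. x $ (i, a))"

definition unblk :: "('n::finite \<Rightarrow> real^3) \<Rightarrow> real^('n \<times> 3)" where
  "unblk f = (\<chi> p. f (fst p) $ snd p)"

lemma blk_unblk [simp]: "blk (unblk f) i = f i"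
  by (simp add: blk_def unblk_def vec_eq_iff)

lemma blk_eq_iff: "x = y \<longleftrightarrow> (\<forall>i. blk x i = blk y i)"
  by (auto simp: blk_def vec_eq_iff)

lemma blk_add [simp]: "blk (x + y) i = blk x i + blk y i"
  by (simp add: blk_def vec_eq_iff)

lemma blk_scaleR [simp]: "blk (c *\<^sub>R x) i = c *\<^sub>R blk x i"
  by (simp add: blk_def vec_eq_iff)

lemma blk_0 [simp]: "blk 0 i = 0"
  by (simp add: blk_def vec_eq_iff)

definition nview_block :: "('n \<Rightarrow> 'n \<Rightarrow> real) \<Rightarrow> ('n \<Rightarrow> 'n \<Rightarrow> real^3^3) \<Rightarrow> 'n \<Rightarrow> 'n \<Rightarrow> real^3^3" where
  "nview_block l F i j = (if i = j then 0 else l i j *\<^sub>R F i j)"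

lemma sum_prod_UNIV: "(\<Sum>p\<in>UNIV. f p) = (\<Sum>i\<in>UNIV. \<Sum>a\<in>UNIV. f (i, a))"
  by (simp add: sum.cartesian_product flip: UNIV_Times_UNIV)

lemma nview_mult: "blk (nview_matrix l F *v x) i = (\<Sum>j\<in>UNIV. nview_block l F i j *v blk x j)"
proof -
  have "(\<Sum>a\<in>UNIV. nview_matrix l F $ (i, b) $ (j, a) * x $ (j, a)) = (nview_block l F i j *v blk x j) $ b" for b j
    by (simp add: nview_matrix_def nview_block_def blk_def matrix_vector_mult_def)
  then have "(nview_matrix l F *v x) $ (i, b) = (\<Sum>j\<in>UNIV. (nview_block l F i j *v blk x j) $ b)" for b
    by (simp add: matrix_vector_mult_def[of "nview_matrix l F"] sum_prod_UNIV)
  then show ?thesis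
    by (simp add: vec_eq_iff blk_def)
qed

lemma block_row_mult: "block_row M i *v x = blk (M *v x) i"
  by (simp add: block_row_def blk_def matrix_vector_mult_def)

lemma block_col_eq_transpose_block_row:
  assumes "transpose M = M"
  shows "block_col M j = transpose (block_row M j)"
proof -
  have "M $ r $ c = M $ c $ r" for r c
  proof -
    have "M $ r $ c = transpose M $ c $ r"
      by (simp add: transpose_def)
    with assms show ?thesis by simp
  qed
  then show ?thesis
    by (simp add: block_col_def block_row_def transpose_def)
qed

lemma transpose_nview_matrix:
  assumes "\<And>i j. i \<noteq> j \<Longrightarrow> l i j = l j i" "\<And>i j. i \<noteq> j \<Longrightarrow> F j i = transpose (F i j)"
  shows "transpose (nview_matrix l F) = nview_matrix l F"
proof -
  have "F j i $ b $ a = F i j $ a $ b" if "i \<noteq> j" for i j a b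
    using assms(2)[OF that] by (simp add: transpose_def)
  then show ?thesis
    using assms(1) by (simp add: nview_matrix_def transpose_def vec_eq_iff)
qed

lemma linear_surj_if_no_orthogonal:
  fixes f :: "'a::euclidean_space \<Rightarrow> 'b::euclidean_space"
  assumes "linear f" "\<And>q. (\<And>x. q \<bullet> f x = 0) \<Longrightarrow> q = 0"
  shows "surj f"
proof (rule ccontr)
  assume "\<not> surj f"
  moreover have sub: "subspace (range f)"
    using assms(1) by (simp add: linear_subspace_image)
  ultimately have "dim (range f) < DIM('b)"
    by (metis dim_eq_full dim_subset_UNIV le_neq_implies_less span_eq_iff)
  then obtain q where "q \<noteq> 0" "\<And>y. y \<in> span (range f) \<Longrightarrow> orthogonal q y"
    using orthogonal_to_subspace_exists by blast
  then show False
    using assms(2)[of q] by (simp add: orthogonal_def span_base)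
qed

text \<open>The block matrix with blocks \<open>V\<^sub>i (T\<^sub>i - T\<^sub>j) V\<^sub>j\<^sup>T\<close> factors through the moments
  \<open>\<Sum>y\<^sub>j\<close> and \<open>\<Sum>T\<^sub>j y\<^sub>j\<close> of \<open>y\<^sub>j = V\<^sub>j\<^sup>T x\<^sub>j\<close>.\<close>

definition moments :: "('n::finite \<Rightarrow> real^3^3) \<Rightarrow> ('n \<Rightarrow> real^3^3) \<Rightarrow> real^('n \<times> 3) \<Rightarrow> (real^3) \<times> (real^3)" where
  "moments V T x = (\<Sum>j\<in>UNIV. transpose (V j) *v blk x j, \<Sum>j\<in>UNIV. T j *v (transpose (V j) *v blk x j))"

lemma linear_moments: "linear (moments V T)"
  by (rule linearI) (simp_all add: moments_def matrix_vector_right_distrib matrix_vector_mult_scaleR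
      sum.distrib scaleR_sum_right)

text \<open>A vector \<open>(p, q)\<close> orthogonal to the range is tested on vectors supported in
  a single block \<open>j\<close>; since \<open>V j\<close> is invertible, this yields the equation
  in the hypothesis \<open>T\<close>.\<close>

lemma surj_moments:
  assumes inv: "\<And>i. invertible (V i)"
    and T: "\<And>p q. (\<And>j. p + transpose (T j) *v q = 0) \<Longrightarrow> p = 0 \<and> q = 0"
  shows "surj (moments V T)"
proof (rule linear_surj_if_no_orthogonal[OF linear_moments])
  fix r assume r: "\<And>x. r \<bullet> moments V T x = 0"
  obtain p q where pq: "r = (p, q)" by force
  have "p + transpose (T j) *v q = 0" for j
  proof -
    define u where "u = p + transpose (T j) *v q"
    obtain W where W: "transpose (V j) ** W = mat 1"
      using transpose_invertible[OF inv] invertible_right_inverse by blast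
    \<comment> \<open>The only nonzero block is chosen so that the test value becomes
      \<open>u \<bullet> u\<close>.\<close>
    define x where "x = unblk (\<lambda>k. if k = j then W *v u else 0)"
    have "transpose (V k) *v blk x k = (if k = j then u else 0)" for k
      using W by (simp add: x_def matrix_vector_mul_assoc)
    moreover have "T k *v (if k = j then u else 0) = (if k = j then T k *v u else 0)" for k
      by simp
    ultimately have "moments V T x = (u, T j *v u)"
      by (simp add: moments_def)
    with r[of x] have "u \<bullet> u = 0"
      by (simp add: pq inner_matrix_transpose u_def[symmetric] flip: inner_add_left)
    then show ?thesis
      by (simp add: u_def)
  qed
  then have "p = 0 \<and> q = 0"
    by (rule T)
  then show "r = 0"
    by (simp add: pq zero_prod_def)
qed

text \<open>If \<open>t i \<times> X\<close> does not depend on \<open>i\<close>, all differences of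
  the \<open>t i\<close> are parallel to \<open>X\<close>, which for nonzero \<open>X\<close> puts
  them on a line.\<close>

lemma cross_constant_imp_zero:
  assumes "\<not> collinear (range t)" "\<And>i. t i \<times> X = Y"
  shows "X = 0 \<and> Y = 0"
proof -
  have "X = 0"
  proof (rule ccontr)
    assume X: "X \<noteq> 0"
    have "\<exists>c. t i = t j + c *\<^sub>R X" for i j
    proof -
      have "X \<times> (t i - t j) = 0"
        using assms(2)[of i] assms(2)[of j] cross_skew[of X "t i - t j"]
        by (simp add: Cross3.left_diff_distrib)
      then obtain c where "t i - t j = c *\<^sub>R X"
        using X by (rule cross_eq_0_imp_parallel)
      then show ?thesis
        by (intro exI[of _ c]) (simp add: algebra_simps)
    qed
    then have "collinear (range t)"
      unfolding collinear_alt by blast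
    with assms(1) show False by blast
  qed
  then show ?thesis
    using assms(2) by force
qed

lemma rank_mul_invertible_left:
  fixes A :: "real^'n^'m" and V :: "real^'m^'m"
  assumes "invertible V"
  shows "rank (V ** A) = rank A"
proof -
  obtain W where "W ** V = mat 1"
    using assms invertible_left_inverse by blast
  then have "rank (W ** (V ** A)) = rank A"
    by (simp add: matrix_mul_assoc)
  then show ?thesis
    using rank_mul_le_right[of W "V ** A"] rank_mul_le_right[of V A] by linarith
qed

lemma rank_skew:
  assumes "d \<noteq> 0"
  shows "rank (skew d) = 2"
proof -
  have "{x. skew d *v x = 0} = span {d}"
    using assms by (auto simp: span_singleton cross_mult_right elim: cross_eq_0_imp_parallel)
  then show ?thesis
    using rank_nullity[of "skew d"] assms by simp
qed

lemma invertible_mult_eq_0_iff: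
  fixes V :: "real^'n^'n"
  assumes "invertible V"
  shows "V *v x = 0 \<longleftrightarrow> x = 0"
  using inj_matrix_vector_mult[OF assms] linear_injective_0[OF matrix_vector_mul_linear, of V] by auto

text \<open>Expanding \<open>(t i - t j) \<times> y j\<close> and summing over \<open>j\<close>
  leaves only the two moments of \<open>y\<close>. The matrix therefore factors through a
  six-dimensional space, by a surjection \<open>\<Psi>\<close> followed by an injection
  \<open>\<Phi>\<close>; both properties come from \<open>cross_constant_imp_zero\<close>.\<close>

lemma nview_rank_noncollinear:
  fixes t :: "'n::finite \<Rightarrow> real^3"
  assumes inv: "\<And>i. invertible (V i)"
    and blocks: "\<And>i j. i \<noteq> j \<Longrightarrow> l i j *\<^sub>R F i j = V i ** skew (t i - t j) ** transpose (V j)"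
    and nc: "\<not> collinear (range t)"
  shows "rank (nview_matrix l F) = 6" and "rank (block_row (nview_matrix l F) i) = 3"
proof -
  define \<Phi> where "\<Phi> = (\<lambda>(X, Y). unblk (\<lambda>i. V i *v (t i \<times> X - Y)))"
  define \<Psi> where "\<Psi> = moments V (\<lambda>i. skew (t i))"
  have block: "nview_block l F i j = V i ** skew (t i - t j) ** transpose (V j)" for i j
    by (auto simp: nview_block_def blocks matrix_eq simp flip: matrix_vector_mul_assoc)
  have M: "nview_matrix l F *v x = \<Phi> (\<Psi> x)" for x
  proof -
    have "(\<Sum>j\<in>UNIV. nview_block l F i j *v blk x j) = blk (\<Phi> (\<Psi> x)) i" for i
    proof -
      have "(\<Sum>j\<in>UNIV. nview_block l F i j *v blk x j)
          = V i *v (\<Sum>j\<in>UNIV. (t i - t j) \<times> (transpose (V j) *v blk x j))"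
        by (simp add: block linear_sum[OF matrix_vector_mul_linear] flip: matrix_vector_mul_assoc)
      also have "(\<Sum>j\<in>UNIV. (t i - t j) \<times> (transpose (V j) *v blk x j))
          = (\<Sum>j\<in>UNIV. skew (t i) *v (transpose (V j) *v blk x j)) - snd (\<Psi> x)"
        by (simp add: \<Psi>_def moments_def Cross3.left_diff_distrib sum_subtractf)
      also have "(\<Sum>j\<in>UNIV. skew (t i) *v (transpose (V j) *v blk x j)) = t i \<times> fst (\<Psi> x)"
        by (simp add: \<Psi>_def moments_def flip: linear_sum[OF matrix_vector_mul_linear] skew_mult)
      finally show ?thesis
        by (simp add: \<Phi>_def split_beta)
    qed
    then show ?thesis
      unfolding blk_eq_iff nview_mult by blast
  qed
  have surj: "surj \<Psi>"
    unfolding \<Psi>_def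
  proof (rule surj_moments[OF inv])
    fix p q :: "real^3" assume *: "\<And>j. p + transpose (skew (t j)) *v q = 0"
    have "t j \<times> q = p" for j
      using *[of j] by (simp add: transpose_skew uminus_matrix_vector_mult)
    from cross_constant_imp_zero[OF nc this] show "p = 0 \<and> q = 0" by blast
  qed
  have lin: "linear \<Phi>"
    by (rule linearI) (auto simp: \<Phi>_def blk_eq_iff cross_add_right cross_mult_right algebra_simps)
  have inj: "inj \<Phi>"
    unfolding linear_injective_0[OF lin]
  proof (intro allI impI)
    fix p assume *: "\<Phi> p = 0"
    obtain X Y where p: "p = (X, Y)" by force
    have "t i \<times> X = Y" for i
    proof -
      have "V i *v (t i \<times> X - Y) = 0"
        using * by (simp add: p \<Phi>_def blk_eq_iff)
      then show ?thesis
        using invertible_mult_eq_0_iff[OF inv] by force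
    qed
    from cross_constant_imp_zero[OF nc this] show "p = 0"
      by (simp add: p zero_prod_def)
  qed
  have "range ((*v) (nview_matrix l F)) = \<Phi> ` UNIV"
    using surj by (auto simp: M) (metis surjD rangeI)
  then have "rank (nview_matrix l F) = dim (UNIV :: ((real^3) \<times> (real^3)) set)"
    using dim_image_eq[OF lin, of UNIV] inj by (simp add: rank_dim_range)
  then show "rank (nview_matrix l F) = 6"
    by simp
  have "surj ((*v) (block_row (nview_matrix l F) i))"
    unfolding surj_def
  proof
    fix z
    obtain W where W: "V i ** W = mat 1"
      using inv invertible_right_inverse by blast
    \<comment> \<open>At the moments \<open>(0, - (W *v z))\<close> the block \<open>i\<close> of
      \<open>\<Phi>\<close> is \<open>V i *v (W *v z) = z\<close>.\<close>
    obtain x where "\<Psi> x = (0, - (W *v z))"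
      using surj by (metis surjD)
    then have "z = block_row (nview_matrix l F) i *v x"
      using W by (simp add: block_row_mult M \<Phi>_def matrix_vector_mul_assoc)
    then show "\<exists>x. z = block_row (nview_matrix l F) i *v x" by blast
  qed
  then show "rank (block_row (nview_matrix l F) i) = 3"
    using full_rank_surjective[of "block_row (nview_matrix l F) i"] by simp
qed

text \<open>All differences of centers are multiples of \<open>d\<close>, so scalar-weighted moments
  suffice. Cross products with \<open>d\<close> lose the component along \<open>d\<close>, and what
  survives is a pair of vectors in the plane orthogonal to \<open>d\<close>: dimension
  \<open>2 + 2\<close>.\<close>

lemma nview_rank_collinear:
  fixes t :: "'n::finite \<Rightarrow> real^3"
  assumes inv: "\<And>i. invertible (V i)"
    and blocks: "\<And>i j. i \<noteq> j \<Longrightarrow> l i j *\<^sub>R F i j = V i ** skew (t i - t j) ** transpose (V j)"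
    and coll: "collinear (range t)" and ne: "t a \<noteq> t b"
  shows "rank (nview_matrix l F) = 4" and "rank (block_row (nview_matrix l F) i) = 2"
proof -
  obtain u d where "\<forall>i. \<exists>c. t i = u + c *\<^sub>R d"
    using coll by (auto simp: collinear_alt)
  then obtain \<beta> where t: "\<And>i. t i = u + \<beta> i *\<^sub>R d"
    by metis
  with ne have d: "d \<noteq> 0" and \<beta>: "\<beta> a \<noteq> \<beta> b" by auto
  define \<Phi> where "\<Phi> = (\<lambda>(X, Y). unblk (\<lambda>i. V i *v (d \<times> (\<beta> i *\<^sub>R X - Y))))"
  define \<Psi> where "\<Psi> = moments V (\<lambda>i. mat (\<beta> i))"
  have matb: "mat c *v (x :: real^3) = c *\<^sub>R x" for c x
    by (simp add: vec_eq_iff forall_3 mat_def matrix_vector_mult_def sum_3)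
  have zero: "X = 0 \<and> Y = 0" if "\<And>i. \<beta> i *\<^sub>R X = Y" for X Y :: "real^3"
  proof -
    have "(\<beta> a - \<beta> b) *\<^sub>R X = 0"
      using that[of a] that[of b] by (simp add: scaleR_left_diff_distrib)
    with \<beta> have "X = 0" by simp
    with that[of a] show ?thesis by simp
  qed
  have block: "nview_block l F i j = V i ** skew (t i - t j) ** transpose (V j)" for i j
    by (auto simp: nview_block_def blocks matrix_eq simp flip: matrix_vector_mul_assoc)
  have M: "nview_matrix l F *v x = \<Phi> (\<Psi> x)" for x
  proof -
    have "(\<Sum>j\<in>UNIV. nview_block l F i j *v blk x j) = blk (\<Phi> (\<Psi> x)) i" for i
    proof -
      have "(\<Sum>j\<in>UNIV. nview_block l F i j *v blk x j)
          = V i *v (\<Sum>j\<in>UNIV. (t i - t j) \<times> (transpose (V j) *v blk x j))"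
        by (simp add: block linear_sum[OF matrix_vector_mul_linear] flip: matrix_vector_mul_assoc)
      also have "(\<Sum>j\<in>UNIV. (t i - t j) \<times> (transpose (V j) *v blk x j))
          = skew d *v (\<Sum>j\<in>UNIV. \<beta> i *\<^sub>R (transpose (V j) *v blk x j) - \<beta> j *\<^sub>R (transpose (V j) *v blk x j))"
        unfolding linear_sum[OF matrix_vector_mul_linear]
        by (simp add: t cross_mult_left cross_mult_right
            flip: scaleR_left_diff_distrib)
      also have "(\<Sum>j\<in>UNIV. \<beta> i *\<^sub>R (transpose (V j) *v blk x j) - \<beta> j *\<^sub>R (transpose (V j) *v blk x j))
          = \<beta> i *\<^sub>R fst (\<Psi> x) - snd (\<Psi> x)"
        by (simp add: \<Psi>_def moments_def matb sum_subtractf scaleR_sum_right)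
      finally show ?thesis
        by (simp add: \<Phi>_def split_beta)
    qed
    then show ?thesis
      unfolding blk_eq_iff nview_mult by blast
  qed
  have surj: "surj \<Psi>"
    unfolding \<Psi>_def
  proof (rule surj_moments[OF inv])
    fix p q :: "real^3" assume *: "\<And>j. p + transpose (mat (\<beta> j)) *v q = 0"
    have "\<beta> j *\<^sub>R q = - p" for j
      using *[of j] by (simp add: matb eq_neg_iff_add_eq_0 add.commute)
    from zero[OF this] show "p = 0 \<and> q = 0" by simp
  qed
  have lin: "linear \<Phi>"
    by (rule linearI) (auto simp: \<Phi>_def blk_eq_iff cross_add_right cross_mult_right Cross3.right_diff_distrib algebra_simps)
  define T where "T = Sigma {x. d \<bullet> x = 0} (\<lambda>_. {x. d \<bullet> x = 0})"
  have T: "subspace T"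
    unfolding T_def by (intro subspace_Times subspace_hyperplane)
  have inj: "inj_on \<Phi> T"
    unfolding linear_injective_on_subspace_0[OF lin T]
  proof (intro ballI impI)
    fix p assume "p \<in> T" and *: "\<Phi> p = 0"
    then obtain X Y where p: "p = (X, Y)" and XY: "d \<bullet> X = 0" "d \<bullet> Y = 0"
      by (auto simp: T_def)
    have "\<beta> i *\<^sub>R X = Y" for i
    proof -
      have "V i *v (d \<times> (\<beta> i *\<^sub>R X - Y)) = 0"
        using * by (simp add: p \<Phi>_def blk_eq_iff)
      then have "d \<times> (\<beta> i *\<^sub>R X - Y) = 0"
        by (simp add: invertible_mult_eq_0_iff[OF inv])
      moreover have "d \<bullet> (\<beta> i *\<^sub>R X - Y) = 0"
        using XY by (simp add: inner_diff_right)
      ultimately show ?thesis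
        using norm_and_cross_eq_0[of d "\<beta> i *\<^sub>R X - Y"] d by simp
    qed
    from zero[OF this] show "p = 0"
      by (simp add: p zero_prod_def)
  qed
  \<comment> \<open>Orthogonal projection along \<open>d\<close> does not change cross products with
    \<open>d\<close>, so restricting \<open>\<Phi>\<close> to \<open>T\<close> keeps its whole
    image.\<close>
  have "range \<Phi> \<subseteq> \<Phi> ` T"
  proof clarify
    fix X Y
    define \<pi> where "\<pi> x = x - ((d \<bullet> x) / (d \<bullet> d)) *\<^sub>R d" for x
    have "d \<bullet> \<pi> x = 0" for x
      using d by (simp add: \<pi>_def inner_diff_right)
    then have "(\<pi> X, \<pi> Y) \<in> T"
      by (simp add: T_def)
    moreover have "d \<times> \<pi> x = d \<times> x" for x
      by (simp add: \<pi>_def Cross3.right_diff_distrib cross_mult_right)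
    then have "\<Phi> (\<pi> X, \<pi> Y) = \<Phi> (X, Y)"
      by (simp add: \<Phi>_def blk_eq_iff Cross3.right_diff_distrib cross_mult_right)
    ultimately show "\<Phi> (X, Y) \<in> \<Phi> ` T"
      by (metis imageI)
  qed
  moreover have "range ((*v) (nview_matrix l F)) = range \<Phi>"
    using surj by (auto simp: M) (metis surjD rangeI)
  ultimately have "range ((*v) (nview_matrix l F)) = \<Phi> ` T"
    by auto
  then have "rank (nview_matrix l F) = dim T"
    using dim_image_eq[OF lin, of T] inj T by (simp add: rank_dim_range span_eq_iff[THEN iffD2])
  also have "\<dots> = 4"
    unfolding T_def using d by (simp add: dim_Times subspace_hyperplane dim_hyperplane)
  finally show "rank (nview_matrix l F) = 4" .
  have "range ((*v) (block_row (nview_matrix l F) i)) = range ((*v) (V i ** skew d))"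
  proof (intro equalityI subsetI)
    fix z assume "z \<in> range ((*v) (block_row (nview_matrix l F) i))"
    then show "z \<in> range ((*v) (V i ** skew d))"
      by (auto simp: block_row_mult M \<Phi>_def split_beta simp flip: matrix_vector_mul_assoc)
  next
    fix z assume "z \<in> range ((*v) (V i ** skew d))"
    then obtain y where y: "z = V i *v (d \<times> y)"
      by (auto simp flip: matrix_vector_mul_assoc)
    obtain x where "\<Psi> x = (0, - y)"
      using surj by (metis surjD)
    then have "z = block_row (nview_matrix l F) i *v x"
      by (simp add: block_row_mult M \<Phi>_def y)
    then show "z \<in> range ((*v) (block_row (nview_matrix l F) i))" by blast
  qed
  then have "rank (block_row (nview_matrix l F) i) = rank (V i ** skew d)"
    by (simp only: rank_dim_range)
  then show "rank (block_row (nview_matrix l F) i) = 2"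
    by (simp add: rank_mul_invertible_left[OF inv] rank_skew[OF d])
qed

subsection \<open>Factorization of a block matrix of rank 6\<close>

lemma matrix_add_rdistrib: "(A + B) ** C = A ** C + B ** C"
  for A B :: "'a::semiring_1^'n^'m"
  by (simp add: matrix_matrix_mult_def vec_eq_iff sum.distrib distrib_right)

lemma matrix_mult_nth: "(A ** B) $ i $ j = A $ i \<bullet> column j B"
  for A :: "real^'n^'m"
  by (simp add: matrix_matrix_mult_def column_def inner_vec_def)

lemma rank_scaleR:
  fixes A :: "real^'n^'m"
  assumes "c \<noteq> 0"
  shows "rank (c *\<^sub>R A) = rank A"
proof -
  have "{x. (c *\<^sub>R A) *v x = 0} = {x. A *v x = 0}"
    using assms by (simp flip: scaleR_matrix_vector_assoc)
  then show ?thesis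
    using rank_nullity[of "c *\<^sub>R A"] rank_nullity[of A] by simp
qed

text \<open>This is the \<open>E\<close> of \<open>isotropic_decomposition\<close>: its columns span
  the coordinates of view \<open>k\<close>, an isotropic space because the diagonal block of the
  view vanishes.\<close>

definition block_selector :: "'n::finite \<Rightarrow> real^3^('n \<times> 3)" where
  "block_selector k = (\<chi> p b. if p = (k, b) then 1 else 0)"

lemma mult_block_selector: "M ** block_selector k = block_col M k"
  by (simp add: block_selector_def block_col_def matrix_matrix_mult_def vec_eq_iff if_distrib cong: if_cong)

lemma block_selector_nview_col: "transpose (block_selector k) ** block_col (nview_matrix l F) k = 0"
proof -
  have "(transpose (block_selector k) ** block_col (nview_matrix l F) k) $ a $ b
      = nview_matrix l F $ (k, a) $ (k, b)" for a b
    by (simp add: block_selector_def block_col_def matrix_matrix_mult_def transpose_def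
        if_distrib[of "\<lambda>x. x * _"] cong: if_cong)
  then show ?thesis
    by (simp add: vec_eq_iff nview_matrix_def)
qed

definition row_block :: "real^3^('n::finite \<times> 3) \<Rightarrow> 'n \<Rightarrow> real^3^3" where
  "row_block A i = (\<chi> a b. A $ (i, a) $ b)"

lemma row_block_mult_transpose:
  "(row_block A i ** transpose (row_block B j)) $ a $ b = (A ** transpose B) $ (i, a) $ (j, b)"
  by (simp add: row_block_def matrix_matrix_mult_def transpose_def)

lemma nview_block_nth: "nview_block l F i j $ a $ b = nview_matrix l F $ (i, a) $ (j, b)"
  by (simp add: nview_block_def nview_matrix_def)

lemma nview_decomposition:
  assumes "transpose (nview_matrix l F) = nview_matrix l F"
    and "rank (nview_matrix l F) = 2 * rank (block_col (nview_matrix l F) k)"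
  obtains A B where "B = (\<lambda>i. nview_block l F i k)"
    "\<And>i j. nview_block l F i j = A i ** transpose (B j) + B i ** transpose (A j)"
proof -
  define B where "B = block_col (nview_matrix l F) k"
  have "\<exists>A. nview_matrix l F = A ** transpose B + B ** transpose A"
    using isotropic_decomposition[of "nview_matrix l F" "block_selector k"] assms
      block_selector_nview_col[of k l F]
    unfolding mult_block_selector B_def by metis
  then obtain A where A: "nview_matrix l F = A ** transpose B + B ** transpose A"
    by blast
  have "row_block B = (\<lambda>i. nview_block l F i k)"
    by (simp add: fun_eq_iff vec_eq_iff nview_block_nth row_block_def B_def block_col_def)
  moreover have "nview_block l F i j = row_block A i ** transpose (row_block B j)
      + row_block B i ** transpose (row_block A j)" for i j
    by (simp add: vec_eq_iff nview_block_nth row_block_mult_transpose) (simp add: A)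
  ultimately show ?thesis
    using that by blast
qed

lemma range_transpose_rank_2:
  fixes B :: "real^3^3"
  assumes "rank B = 2" "B *v e = 0" "e \<noteq> 0" "e \<bullet> x = 0"
  obtains y where "x = transpose B *v y"
proof -
  have "range ((*v) (transpose B)) = {x. e \<bullet> x = 0}"
  proof (rule subspace_dim_equal)
    show "range ((*v) (transpose B)) \<subseteq> {x. e \<bullet> x = 0}"
      using assms(2) by (auto simp: inner_matrix_transpose)
    show "dim {x. e \<bullet> x = 0} \<le> dim (range ((*v) (transpose B)))"
      using assms(1,3) by (simp add: dim_hyperplane rank_transpose flip: rank_dim_range)
  qed (auto simp: subspace_hyperplane intro: linear_subspace_image)
  with assms(4) that show ?thesis by blast
qed

text \<open>The range of \<open>transpose B\<close> is the orthogonal complement of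
  \<open>e\<close>, so together with \<open>e\<close> it spans the space, and \<open>A\<close>
  vanishes on both.\<close>

lemma eq_zero_on_kernel_complement:
  fixes A B :: "real^3^3"
  assumes B: "rank B = 2" "B *v e = 0" "e \<noteq> 0"
    and A: "A *v e = 0" "A ** transpose B = 0"
  shows "A = 0"
proof -
  have "A *v x = 0" for x
  proof -
    define c where "c = (e \<bullet> x) / (e \<bullet> e)"
    have "e \<bullet> (x - c *\<^sub>R e) = 0"
      using B(3) by (simp add: c_def inner_diff_right)
    then obtain y where "x - c *\<^sub>R e = transpose B *v y"
      using range_transpose_rank_2[OF B] by blast
    then have "A *v (x - c *\<^sub>R e) = 0"
      using A(2) by (simp add: matrix_vector_mul_assoc)
    with A(1) show ?thesis
      by (simp add: matrix_vector_mult_diff_distrib matrix_vector_mult_scaleR)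
  qed
  then show ?thesis
    by (simp add: matrix_eq)
qed

text \<open>Otherwise \<open>B ** skew e = 0\<close>, and every \<open>e \<times> x\<close> would
  lie in the kernel line of \<open>B\<close>, which is spanned by \<open>e\<close>; being orthogonal
  to \<open>e\<close>, it would be zero.\<close>

lemma conj_skew_kernel_nonzero:
  fixes B :: "real^3^3"
  assumes B: "rank B = 2" "B *v e = 0" "e \<noteq> 0"
  shows "B ** skew e ** transpose B \<noteq> 0"
proof
  assume 0: "B ** skew e ** transpose B = 0"
  have "B ** skew e = 0"
    by (rule eq_zero_on_kernel_complement[OF B _ 0]) (simp flip: matrix_vector_mul_assoc)
  then have ker: "B *v (e \<times> x) = 0" for x
    by (metis matrix_vector_mul_assoc matrix_vector_mult_0 skew_mult)
  have "rank B + 1 = CARD(3)"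
    using B(1) by simp
  then obtain k where k: "\<And>x. B *v x = 0 \<longleftrightarrow> (\<exists>c. x = c *\<^sub>R k)"
    using kernel_spanned by metis
  obtain a where a: "e = a *\<^sub>R k"
    using k B(2) by blast
  have "e \<times> x = 0" for x
  proof -
    obtain b where b: "e \<times> x = b *\<^sub>R k"
      using k ker by blast
    have "e \<bullet> (e \<times> x) = 0"
      by (simp add: dot_cross_self)
    then have "b = 0"
      using a b B(3) by auto
    with b show ?thesis by simp
  qed
  with cross_basis_nonzero[OF B(3)] show False by blast
qed

lemma transpose_conj_skew: "transpose (B ** skew z ** transpose B) = - (B ** skew z ** transpose B)"
proof -
  have "transpose (B ** skew z ** transpose B) = B ** (- skew z) ** transpose B"
    by (simp add: matrix_transpose_mul transpose_skew matrix_mul_assoc)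
  then show ?thesis
    by (simp add: matrix_eq uminus_matrix_vector_mult flip: matrix_vector_mul_assoc)
       (metis matrix_vector_mult_diff_distrib matrix_vector_mult_0_right diff_0)
qed

lemma left_kernel_rank_2:
  fixes B :: "real^3^3"
  assumes "rank B = 2"
  obtains m where "m \<noteq> 0" "\<And>x. transpose B *v x = 0 \<longleftrightarrow> (\<exists>c. x = c *\<^sub>R m)"
  using kernel_spanned[of "transpose B"] assms by (auto simp: rank_transpose)

text \<open>Each entry is a linear functional of \<open>z\<close>, so asking it to avoid a value
  excludes only a hyperplane when the functional is nonzero.\<close>

lemma conj_skew_nth: "(B ** skew z ** transpose B) $ p $ q = (B $ q \<times> B $ p) \<bullet> z"
proof -
  have "(B ** skew z ** transpose B) $ p $ q = B $ p \<bullet> column q (skew z ** transpose B)"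
    by (simp add: matrix_mult_nth flip: matrix_mul_assoc)
  also have "column q (skew z ** transpose B) = skew z *v (B $ q)"
    by (simp add: column_def matrix_matrix_mult_def matrix_vector_mult_def transpose_def vec_eq_iff)
  also have "B $ p \<bullet> (skew z *v (B $ q)) = (B $ q \<times> B $ p) \<bullet> z"
    by (metis cross_triple inner_commute skew_mult)
  finally show ?thesis .
qed

lemma invertible_transpose_kernel:
  fixes V :: "real^'n^'n"
  assumes "\<And>x. transpose V *v x = 0 \<Longrightarrow> x = 0"
  shows "invertible V"
proof -
  have "inj ((*v) (transpose V))"
    using assms by (auto simp: linear_injective_0[OF matrix_vector_mul_linear])
  then have "invertible (transpose V)"
    by (simp add: invertible_left_inverse matrix_left_invertible_injective)
  from transpose_invertible[OF this] show ?thesis by simp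
qed

text \<open>The shift by \<open>z\<close> moves the plane at infinity, and \<open>A + B [z]\<^sub>\<times>\<close> is invertible once that plane misses
  the center of the camera described by \<open>(A, B)\<close>.\<close>

lemma generic_skew_shift_invertible:
  fixes A B :: "real^3^3"
  assumes rank: "rank B = 2"
    and anti: "A ** transpose B + B ** transpose A = 0"
    and joint: "\<And>x. transpose A *v x = 0 \<Longrightarrow> transpose B *v x = 0 \<Longrightarrow> x = 0"
  obtains w c where "w \<noteq> 0" "\<And>z. w \<bullet> z \<noteq> c \<Longrightarrow> invertible (A + B ** skew z)"
proof -
  obtain e where e: "e \<noteq> 0" "B *v e = 0"
    using matrix_nonfull_linear_equations_eq[of B] rank by auto
  obtain m where m: "m \<noteq> 0" "transpose B *v m = 0"
    using left_kernel_rank_2[OF rank] by (metis scaleR_one)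
  \<comment> \<open>An entry that is nonzero for the shift \<open>e\<close> gives a nonzero
    functional \<open>w\<close>; the constant \<open>c\<close> is chosen so that the same entry of
    \<open>K\<close> below is nonzero whenever \<open>w \<bullet> z \<noteq> c\<close>.\<close>
  obtain p q where pq: "(B ** skew e ** transpose B) $ p $ q \<noteq> 0"
    using conj_skew_kernel_nonzero[OF rank e(2,1)] by (auto simp: vec_eq_iff)
  define w where "w = B $ q \<times> B $ p"
  define c where "c = - (A ** transpose B) $ p $ q"
  have "w \<noteq> 0"
    using pq by (auto simp: conj_skew_nth w_def)
  moreover have "invertible (A + B ** skew z)" if z: "w \<bullet> z \<noteq> c" for z
  proof (rule invertible_transpose_kernel)
    fix x assume x: "transpose (A + B ** skew z) *v x = 0"
    \<comment> \<open>\<open>K\<close> is skew-symmetric and nonzero, so its kernel is a line. Both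
      \<open>x\<close> and the left kernel vector \<open>m\<close> of \<open>B\<close> lie on it,
      hence \<open>transpose B\<close> kills \<open>x\<close>, and then so does
      \<open>transpose A\<close>.\<close>
    define K where "K = (A + B ** skew z) ** transpose B"
    have K: "K = A ** transpose B + B ** skew z ** transpose B"
      by (simp add: K_def matrix_add_rdistrib)
    have "transpose K = - K"
    proof -
      have "transpose (A ** transpose B) = - (A ** transpose B)"
        using anti by (simp add: matrix_transpose_mul add_eq_0_iff)
      then show ?thesis
        unfolding K transpose_add transpose_conj_skew by simp
    qed
    then obtain k where k: "K = skew k"
      by (rule antisymmetric_imp_skew)
    have "K $ p $ q \<noteq> 0"
      using z by (simp add: K conj_skew_nth c_def w_def)
    then have "k \<noteq> 0"
      unfolding k by (auto simp: skew_def matrix_def)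
    have "transpose K *v x = 0"
      using x by (simp add: K_def matrix_transpose_mul flip: matrix_vector_mul_assoc)
    then have "k \<times> x = 0"
      by (simp add: k transpose_skew uminus_matrix_vector_mult)
    then obtain a where a: "x = a *\<^sub>R k"
      using \<open>k \<noteq> 0\<close> by (rule cross_eq_0_imp_parallel)
    have "k \<times> m = 0"
      using m(2) k by (metis K_def matrix_vector_mul_assoc matrix_vector_mult_0_right skew_mult)
    then obtain b where b: "m = b *\<^sub>R k"
      using \<open>k \<noteq> 0\<close> by (rule cross_eq_0_imp_parallel)
    with m(1) have "b \<noteq> 0" by auto
    then have xm: "x = (a / b) *\<^sub>R m"
      by (simp add: a b)
    have "transpose B *v x = 0"
      by (simp add: xm m(2) matrix_vector_mult_scaleR)
    moreover have "transpose A *v x = 0"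
      using x \<open>transpose B *v x = 0\<close>
      by (simp add: transpose_add matrix_transpose_mul matrix_vector_mult_add_rdistrib
          flip: matrix_vector_mul_assoc)
    ultimately show "x = 0"
      using joint by blast
  qed
  ultimately show ?thesis
    using that by blast
qed

lemma nview_factorization_noncollinear:
  fixes F :: "'n::finite \<Rightarrow> 'n \<Rightarrow> real^3^3"
  assumes sym: "transpose (nview_matrix l F) = nview_matrix l F"
    and l: "\<And>i j. i \<noteq> j \<Longrightarrow> l i j \<noteq> 0"
    and F: "\<And>i j. i \<noteq> j \<Longrightarrow> rank (F i j) = 2"
    and rank: "rank (nview_matrix l F) = 6" "\<And>i. rank (block_row (nview_matrix l F) i) = 3"
  obtains V t where "\<And>i. invertible (V i)"
    "\<And>i j. nview_block l F i j = V i ** skew (t i - t j) ** transpose (V j)"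
proof -
  fix k :: 'n
  have "rank (block_col (nview_matrix l F) k) = 3"
    by (simp add: block_col_eq_transpose_block_row[OF sym] rank_transpose rank(2))
  then have "rank (nview_matrix l F) = 2 * rank (block_col (nview_matrix l F) k)"
    using rank(1) by simp
  then obtain A B where B: "B = (\<lambda>i. nview_block l F i k)"
    and AB: "\<And>i j. nview_block l F i j = A i ** transpose (B j) + B i ** transpose (A j)"
    by (rule nview_decomposition[OF sym]) blast
  \<comment> \<open>Such an \<open>x\<close> is orthogonal to every block in block row
    \<open>i\<close>, but that row is surjective because its rank is 3.\<close>
  have joint: "x = 0" if "transpose (A i) *v x = 0" "transpose (B i) *v x = 0" for i x
  proof -
    have "surj ((*v) (block_row (nview_matrix l F) i))"
      using full_rank_surjective[of "block_row (nview_matrix l F) i"] rank(2) by simp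
    then obtain y where y: "x = block_row (nview_matrix l F) i *v y"
      by blast
    have "x \<bullet> (nview_block l F i j *v u) = 0" for j u
      using that by (simp add: AB matrix_vector_mult_add_rdistrib inner_add_right inner_matrix_transpose
          flip: matrix_vector_mul_assoc)
    then have "x \<bullet> x = 0"
      by (subst (2) y) (simp add: block_row_mult nview_mult inner_sum_right)
    then show ?thesis by simp
  qed
  have "\<exists>w c. w \<noteq> 0 \<and> (\<forall>z. w \<bullet> z \<noteq> c \<longrightarrow> invertible (A i + B i ** skew z))" if "i \<noteq> k" for i
  proof -
    have "rank (B i) = 2"
      using that F[OF that] l[OF that] by (simp add: B nview_block_def rank_scaleR)
    moreover have "A i ** transpose (B i) + B i ** transpose (A i) = 0"
      using AB[of i i] by (simp add: nview_block_def)
    ultimately show ?thesis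
      using generic_skew_shift_invertible joint by metis
  qed
  then obtain w c where w: "\<And>i. i \<noteq> k \<Longrightarrow> w i \<noteq> 0"
      "\<And>i z. i \<noteq> k \<Longrightarrow> w i \<bullet> z \<noteq> c i \<Longrightarrow> invertible (A i + B i ** skew z)"
    by metis
  \<comment> \<open>One shift serves all views other than \<open>k\<close>, each of which excludes a
    single hyperplane. View \<open>k\<close> is separate: there \<open>B k = 0\<close>, so
    \<open>V k = A k\<close>, and \<open>joint\<close> alone gives invertibility.\<close>
  obtain z where z: "\<And>i. i \<noteq> k \<Longrightarrow> w i \<bullet> z \<noteq> c i"
    using exists_avoiding_hyperplanes[of "- {k}" w c] w(1) by auto
  define V where "V i = A i + B i ** skew z" for i
  have inv: "invertible (V i)" for i
  proof (cases "i = k")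
    case True
    then have "B i = 0" by (simp add: B nview_block_def)
    then show ?thesis
      using joint[of i] by (auto simp: V_def transpose_def zero_vec_def[symmetric] intro!: invertible_transpose_kernel)
  next
    case False
    then show ?thesis
      unfolding V_def using w(2) z by blast
  qed
  have VB: "nview_block l F i j = V i ** transpose (B j) + B i ** transpose (V j)" for i j
  proof -
    \<comment> \<open>The two contributions of the shift cancel because \<open>skew z\<close> is
      skew-symmetric.\<close>
    have "B i ** (skew z ** transpose (B j)) + B i ** (transpose (skew z) ** transpose (B j)) = 0"
      by (simp add: transpose_skew matrix_eq uminus_matrix_vector_mult
          flip: matrix_add_ldistrib matrix_add_rdistrib)
    then show ?thesis
      by (simp add: AB V_def transpose_add matrix_transpose_mul matrix_add_ldistrib matrix_add_rdistrib
          add_ac flip: matrix_mul_assoc)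
  qed
  have "\<exists>W. W ** V i = mat 1 \<and> V i ** W = mat 1" for i
    using inv unfolding invertible_def by blast
  then obtain W where W: "\<And>i. W i ** V i = mat 1" "\<And>i. V i ** W i = mat 1"
    by metis
  have "\<exists>t. W i ** B i = skew t" for i
  proof -
    \<comment> \<open>The vanishing diagonal block, stripped of \<open>V i\<close> on both sides,
      says that \<open>W i ** B i\<close> is skew-symmetric.\<close>
    have "W i ** (V i ** transpose (B i) + B i ** transpose (V i)) ** transpose (W i) = 0"
      using VB[of i i] by (simp add: nview_block_def)
    moreover have "transpose (V i) ** transpose (W i) = mat 1"
      using W(1)[of i] by (metis matrix_transpose_mul transpose_mat)
    ultimately have "transpose (W i ** B i) + W i ** B i = 0"
      using W(1)[of i]
      by (simp add: matrix_add_ldistrib matrix_add_rdistrib matrix_transpose_mul matrix_mul_assoc)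
         (metis matrix_mul_assoc matrix_mul_rid matrix_mul_lid)
    then have "transpose (W i ** B i) = - (W i ** B i)"
      by (simp add: add_eq_0_iff2)
    then show ?thesis
      by (metis antisymmetric_imp_skew)
  qed
  then obtain t where t: "\<And>i. W i ** B i = skew (t i)"
    by metis
  have Bt: "B i = V i ** skew (t i)" for i
    using W(2)[of i] by (simp add: t[symmetric] matrix_mul_assoc)
  have "nview_block l F i j = V i ** skew (t i - t j) ** transpose (V j)" for i j
    by (simp add: VB Bt matrix_transpose_mul transpose_skew skew_diff matrix_eq
        matrix_vector_mult_add_rdistrib matrix_vector_mult_diff_rdistrib uminus_matrix_vector_mult
        matrix_vector_mult_diff_distrib Cross3.left_diff_distrib linear_neg[OF matrix_vector_mul_linear]
        flip: matrix_vector_mul_assoc)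
  with inv that show ?thesis by blast
qed

subsection \<open>Factorization of a block matrix of rank 4\<close>

lemma skew_0: "skew 0 = 0"
  by (simp add: matrix_eq)

text \<open>Both \<open>A ** transpose B\<close> and \<open>B ** skew e ** transpose B\<close> are
  skew-symmetric and kill the left kernel vector \<open>m\<close> of \<open>B\<close>, so their axes
  are parallel. Hence \<open>A\<close> and a multiple of \<open>B ** skew e\<close> agree on the
  range of \<open>transpose B\<close>, and both kill \<open>e\<close>.\<close>

lemma antisymmetric_product_eq_skew:
  fixes A B :: "real^3^3"
  assumes B: "rank B = 2" "B *v e = 0" "e \<noteq> 0"
    and A: "A *v e = 0" "A ** transpose B + B ** transpose A = 0"
  obtains c where "A = c *\<^sub>R (B ** skew e)"
proof -
  obtain m where m: "m \<noteq> 0" "transpose B *v m = 0"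
    using left_kernel_rank_2[OF B(1)] by (metis scaleR_one)
  have "transpose (A ** transpose B) = - (A ** transpose B)"
    using A(2) by (simp add: matrix_transpose_mul add_eq_0_iff)
  then obtain k where k: "A ** transpose B = skew k"
    by (rule antisymmetric_imp_skew)
  obtain k' where k': "B ** skew e ** transpose B = skew k'"
    using transpose_conj_skew by (rule antisymmetric_imp_skew)
  have "k' \<noteq> 0"
    using conj_skew_kernel_nonzero[OF B] k' by (auto simp: skew_0)
  have "k \<times> m = 0"
    using m(2) k by (metis matrix_vector_mul_assoc matrix_vector_mult_0_right skew_mult)
  moreover have "k' \<times> m = 0"
    using m(2) k' by (metis matrix_vector_mul_assoc matrix_vector_mult_0_right skew_mult)
  then obtain a where a: "m = a *\<^sub>R k'"
    using \<open>k' \<noteq> 0\<close> by (rule cross_eq_0_imp_parallel)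
  ultimately have "m \<times> k = 0"
    by (metis cross_skew neg_0_equal_iff_equal)
  then obtain b where b: "k = b *\<^sub>R m"
    using m(1) by (rule cross_eq_0_imp_parallel)
  define c where "c = b * a"
  have c: "A ** transpose B = c *\<^sub>R (B ** skew e ** transpose B)"
    by (simp add: k k' a b c_def skew_scaleR)
  have "A - c *\<^sub>R (B ** skew e) = 0"
  proof (rule eq_zero_on_kernel_complement[OF B])
    show "(A - c *\<^sub>R (B ** skew e)) *v e = 0"
      by (simp add: matrix_vector_mult_diff_rdistrib A(1) flip: scaleR_matrix_vector_assoc matrix_vector_mul_assoc)
    show "(A - c *\<^sub>R (B ** skew e)) ** transpose B = 0"
      using c by (simp add: matrix_eq matrix_vector_mult_diff_rdistrib
          flip: scaleR_matrix_vector_assoc matrix_vector_mul_assoc)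
  qed
  then have "A = c *\<^sub>R (B ** skew e)"
    by simp
  then show ?thesis
    by (rule that)
qed

definition outer :: "real^'m \<Rightarrow> real^'n \<Rightarrow> real^'n^'m" where
  "outer u v = (\<chi> i j. u $ i * v $ j)"

lemma outer_mult: "outer u v *v x = (v \<bullet> x) *\<^sub>R u"
  by (simp add: outer_def matrix_vector_mult_def inner_vec_def vec_eq_iff sum_distrib_left sum_distrib_right mult_ac)

lemma transpose_outer: "transpose (outer u v) = outer v u"
  by (simp add: outer_def transpose_def vec_eq_iff mult.commute)

lemma skew_skew_unit:
  assumes "e \<bullet> e = 1"
  shows "e \<times> (e \<times> x) = (e \<bullet> x) *\<^sub>R e - x"
  using assms by (simp add: Lagrange)

text \<open>The common kernel vector \<open>e\<close> fixes each \<open>A i\<close> with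
  \<open>i \<noteq> k\<close> up to a scalar \<open>c i\<close>. Blocks between two such views
  therefore carry a factor \<open>c i - c j\<close>, which the conclusion absorbs.\<close>

lemma nview_factorization_collinear:
  fixes F :: "'n::finite \<Rightarrow> 'n \<Rightarrow> real^3^3"
  assumes sym: "transpose (nview_matrix l F) = nview_matrix l F"
    and l: "\<And>i j. i \<noteq> j \<Longrightarrow> l i j \<noteq> 0"
    and F: "\<And>i j. i \<noteq> j \<Longrightarrow> rank (F i j) = 2"
    and rank: "rank (nview_matrix l F) = 4" "\<And>i. rank (block_col (nview_matrix l F) i) = 2"
  obtains V e where "\<And>i. invertible (V i)"
    "\<And>i j. i \<noteq> j \<Longrightarrow> \<exists>c. c \<noteq> 0 \<and> nview_block l F i j = c *\<^sub>R (V i ** skew e ** transpose (V j))"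
proof -
  fix k :: 'n
  have "rank (nview_matrix l F) = 2 * rank (block_col (nview_matrix l F) k)"
    using rank by simp
  then obtain A0 B where B: "B = (\<lambda>i. nview_block l F i k)"
    and A0B: "\<And>i j. nview_block l F i j = A0 i ** transpose (B j) + B i ** transpose (A0 j)"
    by (rule nview_decomposition[OF sym]) blast
  \<comment> \<open>The block column has three columns and rank 2, so one vector is killed by all
    the \<open>B i\<close> at once.\<close>
  obtain e0 where e0: "e0 \<noteq> 0" "block_col (nview_matrix l F) k *v e0 = 0"
    using matrix_nonfull_linear_equations_eq[of "block_col (nview_matrix l F) k"] rank(2)[of k] by auto
  define e where "e = (1 / norm e0) *\<^sub>R e0"
  have e: "e \<bullet> e = 1"
    using e0(1) by (simp add: e_def dot_square_norm)
  then have "e \<noteq> 0" by auto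
  have Be: "B i *v e = 0" for i
  proof -
    have "B i *v e0 = blk (block_col (nview_matrix l F) k *v e0) i"
      by (simp add: B vec_eq_iff blk_def matrix_vector_mult_def nview_block_nth block_col_def)
    then show ?thesis
      using e0(2) by (simp add: e_def matrix_vector_mult_scaleR)
  qed
  have rank_B: "rank (B i) = 2" if "i \<noteq> k" for i
    using that F[OF that] l[OF that] by (simp add: B nview_block_def rank_scaleR)
  \<comment> \<open>For the unit vector \<open>e\<close> this is the orthogonal projection along
    \<open>e\<close>. Replacing \<open>A0 i\<close> by \<open>A0 i ** Q\<close> keeps the
    decomposition, since \<open>B i ** Q = B i\<close>, and makes \<open>A i\<close> kill
    \<open>e\<close>.\<close>
  define Q where "Q = - (skew e ** skew e)"
  have Q: "Q *v x = x - (e \<bullet> x) *\<^sub>R e" for x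
    using skew_skew_unit[OF e] by (simp add: Q_def uminus_matrix_vector_mult flip: matrix_vector_mul_assoc)
  have tQ: "transpose Q = Q"
    by (simp add: Q_def transpose_minus matrix_transpose_mul transpose_skew)
       (simp add: matrix_eq uminus_matrix_vector_mult linear_neg[OF matrix_vector_mul_linear] flip: matrix_vector_mul_assoc)
  have BQ: "B i ** Q = B i" for i
    by (simp add: matrix_eq Q Be matrix_vector_mult_diff_distrib matrix_vector_mult_scaleR
        flip: matrix_vector_mul_assoc)
  define A where "A i = A0 i ** Q" for i
  have Ae: "A i *v e = 0" for i
    by (simp add: A_def Q e flip: matrix_vector_mul_assoc)
  have QB: "Q ** transpose (B i) = transpose (B i)" for i
    using BQ[of i] by (metis matrix_transpose_mul tQ)
  have AB: "nview_block l F i j = A i ** transpose (B j) + B i ** transpose (A j)" for i j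
  proof -
    have "A i ** transpose (B j) = A0 i ** transpose (B j)"
      by (simp add: A_def QB flip: matrix_mul_assoc)
    moreover have "B i ** transpose (A j) = B i ** transpose (A0 j)"
      by (simp add: A_def matrix_transpose_mul tQ matrix_mul_assoc BQ)
    ultimately show ?thesis
      by (simp add: A0B)
  qed
  have "\<exists>c. A i = c *\<^sub>R (B i ** skew e)" if "i \<noteq> k" for i
  proof -
    have "A i ** transpose (B i) + B i ** transpose (A i) = 0"
      using AB[of i i] by (simp add: nview_block_def)
    then show ?thesis
      using antisymmetric_product_eq_skew[OF rank_B[OF that] Be \<open>e \<noteq> 0\<close> Ae] by metis
  qed
  then obtain c where c: "\<And>i. i \<noteq> k \<Longrightarrow> A i = c i *\<^sub>R (B i ** skew e)"
    by metis
  have "\<exists>m. m \<noteq> 0 \<and> (\<forall>x. transpose (B i) *v x = 0 \<longleftrightarrow> (\<exists>c. x = c *\<^sub>R m))" if "i \<noteq> k" for i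
    using left_kernel_rank_2[OF rank_B[OF that]] by metis
  then obtain m where m: "\<And>i. i \<noteq> k \<Longrightarrow> m i \<noteq> 0"
    "\<And>i x. i \<noteq> k \<Longrightarrow> transpose (B i) *v x = 0 \<longleftrightarrow> (\<exists>c. x = c *\<^sub>R m i)"
    by metis
  \<comment> \<open>The rank-one term sends \<open>e\<close> outside the range of
    \<open>B i\<close>, making the matrix invertible, and disappears in the product with
    \<open>skew e\<close>. The choice at \<open>k\<close> gives
    \<open>skew e ** transpose (V k) = Q\<close>, so that column \<open>k\<close> is reproduced
    exactly.\<close>
  define V where "V i = (if i = k then skew e + outer e e else B i + outer (m i) e)" for i
  have inv: "invertible (V i)" for i
  proof (rule invertible_transpose_kernel)
    fix x assume x: "transpose (V i) *v x = 0"
    show "x = 0"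
    proof (cases "i = k")
      case True
      with x have *: "(e \<bullet> x) *\<^sub>R e = e \<times> x"
        by (simp add: V_def transpose_add transpose_skew transpose_outer outer_mult
            matrix_vector_mult_diff_rdistrib)
      then have "e \<bullet> ((e \<bullet> x) *\<^sub>R e) = 0"
        by (simp add: dot_cross_self)
      then have "e \<bullet> x = 0"
        using e by simp
      with * show ?thesis
        using norm_and_cross_eq_0[of e x] \<open>e \<noteq> 0\<close> by simp
    next
      case False
      with x have *: "transpose (B i) *v x + (m i \<bullet> x) *\<^sub>R e = 0"
        by (simp add: V_def transpose_add transpose_outer outer_mult matrix_vector_mult_add_rdistrib)
      have "e \<bullet> (transpose (B i) *v x) = 0"
        by (simp add: inner_matrix_transpose Be)
      with arg_cong[OF *, of "\<lambda>v. e \<bullet> v"] have mx: "m i \<bullet> x = 0"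
        by (simp add: inner_add_right e)
      with * have "transpose (B i) *v x = 0" by simp
      then obtain b where "x = b *\<^sub>R m i"
        using m(2)[OF False] by blast
      with mx m(1)[OF False] show ?thesis by simp
    qed
  qed
  have VD: "V i ** skew e = B i ** skew e" if "i \<noteq> k" for i
    using that by (simp add: V_def matrix_add_rdistrib)
      (simp add: matrix_eq outer_mult dot_cross_self flip: matrix_vector_mul_assoc)
  have DV: "skew e ** transpose (V i) = skew e ** transpose (B i)" if "i \<noteq> k" for i
  proof -
    have "transpose (V i ** skew e) = transpose (B i ** skew e)"
      using VD[OF that] by simp
    then show ?thesis
      by (simp add: matrix_transpose_mul transpose_skew matrix_eq uminus_matrix_vector_mult flip: matrix_vector_mul_assoc)
  qed
  have Vk: "V i ** skew e ** transpose (V k) = B i" if "i \<noteq> k" for i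
  proof -
    have "skew e *v (transpose (V k) *v x) = Q *v x" for x
      using skew_skew_unit[OF e, of x]
      by (simp add: V_def transpose_add transpose_skew transpose_outer outer_mult Q
          matrix_vector_mult_diff_rdistrib Cross3.right_diff_distrib cross_mult_right)
    then have "skew e ** transpose (V k) = Q"
      by (simp add: matrix_eq del: skew_mult flip: matrix_vector_mul_assoc)
    then show ?thesis
      using VD[OF that] that BQ[of i]
      by (simp add: V_def matrix_add_rdistrib flip: matrix_mul_assoc)
  qed
  have "\<exists>c. c \<noteq> 0 \<and> nview_block l F i j = c *\<^sub>R (V i ** skew e ** transpose (V j))" if "i \<noteq> j" for i j
  proof -
    \<comment> \<open>In the third case this is what forces \<open>c i \<noteq> c j\<close>.\<close>
    have nz: "nview_block l F i j \<noteq> 0"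
      using that l[OF that] F[OF that] by (auto simp: nview_block_def)
    consider "j = k" | "i = k" | "i \<noteq> k" "j \<noteq> k" by blast
    then show ?thesis
    proof cases
      case 1
      with that show ?thesis
        by (intro exI[of _ 1]) (simp add: Vk B)
    next
      case 2
      with that have "j \<noteq> k" by simp
      have "nview_block l F k j = transpose (nview_block l F j k)"
        by (simp add: AB transpose_add matrix_transpose_mul add.commute)
      also have "\<dots> = transpose (V j ** skew e ** transpose (V k))"
        by (simp add: Vk[OF \<open>j \<noteq> k\<close>] B)
      also have "\<dots> = (-1) *\<^sub>R (V k ** skew e ** transpose (V j))"
        by (simp add: matrix_transpose_mul transpose_skew matrix_eq uminus_matrix_vector_mult
            linear_neg[OF matrix_vector_mul_linear] flip: matrix_vector_mul_assoc)
      finally show ?thesis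
        using 2 by (intro exI[of _ "-1"]) simp
    next
      case 3
      have "A i ** transpose (B j) = c i *\<^sub>R (B i ** skew e ** transpose (B j))"
        by (simp add: c 3 scalar_matrix_assoc)
      moreover have "B i ** transpose (A j) = - c j *\<^sub>R (B i ** skew e ** transpose (B j))"
        by (simp add: c 3 transpose_scalar matrix_transpose_mul transpose_skew matrix_scalar_ac)
          (simp add: matrix_eq uminus_matrix_vector_mult linear_neg[OF matrix_vector_mul_linear]
            flip: matrix_vector_mul_assoc scaleR_matrix_vector_assoc)
      ultimately have "nview_block l F i j = (c i - c j) *\<^sub>R (B i ** skew e ** transpose (B j))"
        by (simp add: AB scaleR_left_diff_distrib)
      also have "B i ** skew e ** transpose (B j) = V i ** skew e ** transpose (V j)"
        by (metis 3 VD DV matrix_mul_assoc)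
      finally show ?thesis
        using nz by (intro exI[of _ "c i - c j"]) auto
    qed
  qed
  with inv that show ?thesis by blast
qed

text \<open>Inverting the scalars of the solution turns the blocks into \<open>G i j\<close>.
  Transposition exchanges \<open>G i j\<close> and \<open>G j i\<close>, so comparing multiples of
  the nonzero \<open>F j i\<close> shows that the scalars are symmetric.\<close>

lemma affine_scaling:
  assumes sol: "affine_solution F V t"
    and tr: "\<And>i j. i \<noteq> j \<Longrightarrow> F j i = transpose (F i j)"
    and nz: "\<And>i j. i \<noteq> j \<Longrightarrow> F i j \<noteq> 0"
  obtains l where "\<And>i j. i \<noteq> j \<Longrightarrow> l i j \<noteq> 0 \<and> l i j = l j i"
    "\<And>i j. i \<noteq> j \<Longrightarrow> l i j *\<^sub>R F i j = V i ** skew (t i - t j) ** transpose (V j)"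
proof -
  define G where "G i j = V i ** skew (t i - t j) ** transpose (V j)" for i j
  obtain c where c: "\<And>i j. i \<noteq> j \<Longrightarrow> c i j \<noteq> 0 \<and> F i j = c i j *\<^sub>R G i j"
    using sol unfolding affine_solution_def G_def by metis
  define l where "l i j = 1 / c i j" for i j
  have lG: "l i j *\<^sub>R F i j = G i j" if "i \<noteq> j" for i j
    using c[OF that] by (simp add: l_def)
  have "transpose (G i j) = G j i" for i j
  proof -
    have "- skew (t i - t j) = skew (t j - t i)"
      by (simp add: skew_diff)
    then show ?thesis
      by (simp add: G_def matrix_transpose_mul transpose_skew matrix_mul_assoc)
  qed
  then have "l i j *\<^sub>R F j i = l j i *\<^sub>R F j i" if "i \<noteq> j" for i j
    using lG[OF that] lG[OF that[symmetric]] tr[OF that] by (metis transpose_scalar)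
  then have "l i j = l j i" if "i \<noteq> j" for i j
    using nz[OF that[symmetric]] that by (metis scaleR_cancel_right)
  moreover have "l i j \<noteq> 0" if "i \<noteq> j" for i j
    using c[OF that] by (simp add: l_def)
  ultimately show ?thesis
    using that[of l] lG by (simp add: G_def)
qed

lemma exists_inj_real: "\<exists>s :: 'n::finite \<Rightarrow> real. inj s"
proof -
  obtain f :: "'n \<Rightarrow> nat" where "inj f"
    using finite_imp_inj_to_nat_seg[of "UNIV :: 'n set"] by auto
  then have "inj (\<lambda>i. real (f i))"
    by (simp add: inj_def)
  then show ?thesis by blast
qed

subsection \<open>The characterization\<close>

theorem theorem3p18:
  fixes F :: "'n::finite \<Rightarrow> 'n \<Rightarrow> real^3^3"
  assumes "CARD('n) \<ge> 3"
    and "\<And>i j. i \<noteq> j \<Longrightarrow> is_fundamental (F i j)"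
    and "\<And>i j. i \<noteq> j \<Longrightarrow> F j i = transpose (F i j)"
  shows
    "((\<exists>P. is_solution F P \<and> proj_collinear (range (\<lambda>i. center (P i)))) \<longleftrightarrow>
      (\<exists>l :: 'n \<Rightarrow> 'n \<Rightarrow> real.
         (\<forall>i j. i \<noteq> j \<longrightarrow> l i j \<noteq> 0 \<and> l i j = l j i) \<and>
         rank (nview_matrix l F) = 4 \<and>
         (\<forall>i. rank (block_row (nview_matrix l F) i) = 2) \<and>
         (\<forall>j. rank (block_col (nview_matrix l F) j) = 2)))
     \<and>
     (no_three_epipoles_collinear F \<longrightarrow>
      ((\<exists>P. is_solution F P \<and> \<not> proj_collinear (range (\<lambda>i. center (P i)))) \<longleftrightarrow>
       (\<exists>l :: 'n \<Rightarrow> 'n \<Rightarrow> real.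
          (\<forall>i j. i \<noteq> j \<longrightarrow> l i j \<noteq> 0 \<and> l i j = l j i) \<and>
          rank (nview_matrix l F) = 6 \<and>
          (\<forall>i. rank (block_row (nview_matrix l F) i) = 3) \<and>
          (\<forall>j. rank (block_col (nview_matrix l F) j) = 3))))"
    (is "(?C \<longleftrightarrow> ?C') \<and> (_ \<longrightarrow> (?N \<longleftrightarrow> ?N'))")
proof -
  have rank_F: "rank (F i j) = 2" if "i \<noteq> j" for i j
    using assms(2)[OF that] by (simp add: is_fundamental_def)
  then have nz: "F i j \<noteq> 0" if "i \<noteq> j" for i j
    using that by (metis rank_0 zero_neq_numeral)
  have "\<exists>p q :: 'n. p \<noteq> q"
  proof (rule ccontr)
    assume "\<nexists>p q :: 'n. p \<noteq> q"
    then have "UNIV = {undefined :: 'n}" by auto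
    then have "CARD('n) = card {undefined :: 'n}" by (rule arg_cong)
    with assms(1) show False by simp
  qed
  then obtain p q :: 'n where pq: "p \<noteq> q" by blast
  \<comment> \<open>Coinciding centers would make the block between views \<open>p\<close> and
    \<open>q\<close> zero, although \<open>F p q\<close> has rank 2.\<close>
  have ne: "t p \<noteq> t q"
    if "\<And>i j. i \<noteq> j \<Longrightarrow> l i j \<noteq> 0"
      "\<And>i j. i \<noteq> j \<Longrightarrow> l i j *\<^sub>R F i j = V i ** skew (t i - t j) ** transpose (V j)"
    for l V and t :: "'n \<Rightarrow> real^3"
    using that[OF pq] nz[OF pq] by (auto simp: skew_diff)
  have sym: "transpose (nview_matrix l F) = nview_matrix l F" if "\<forall>i j. i \<noteq> j \<longrightarrow> l i j \<noteq> 0 \<and> l i j = l j i" for l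
    by (rule transpose_nview_matrix) (use that assms(3) in blast)+
  have col: "rank (block_col (nview_matrix l F) i) = rank (block_row (nview_matrix l F) i)"
    if "\<forall>i j. i \<noteq> j \<longrightarrow> l i j \<noteq> 0 \<and> l i j = l j i" for l i
    using block_col_eq_transpose_block_row[OF sym[OF that]] by (simp add: rank_transpose)
  have "?C \<longleftrightarrow> ?C'"
  proof
    assume ?C
    then obtain V t where sol: "affine_solution F V t" and coll: "collinear (range t)"
      using solution_imp_affine by metis
    obtain l where l: "\<And>i j. i \<noteq> j \<Longrightarrow> l i j \<noteq> 0 \<and> l i j = l j i"
      and blocks: "\<And>i j. i \<noteq> j \<Longrightarrow> l i j *\<^sub>R F i j = V i ** skew (t i - t j) ** transpose (V j)"
      using affine_scaling[OF sol assms(3) nz] by metis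
    have inv: "invertible (V i)" for i
      using sol by (simp add: affine_solution_def)
    have "t p \<noteq> t q"
      using ne l blocks by metis
    note ranks = nview_rank_collinear[OF inv blocks coll this]
    show ?C'
      using l ranks col[of l] by (intro exI[of _ l]) auto
  next
    assume ?C'
    then obtain l where l: "\<forall>i j. i \<noteq> j \<longrightarrow> l i j \<noteq> 0 \<and> l i j = l j i"
      and ranks: "rank (nview_matrix l F) = 4" "\<And>j. rank (block_col (nview_matrix l F) j) = 2"
      by blast
    have l0: "l i j \<noteq> 0" if "i \<noteq> j" for i j
      using l that by blast
    obtain V e where inv: "\<And>i. invertible (V i)" and
      V: "\<And>i j. i \<noteq> j \<Longrightarrow> \<exists>c. c \<noteq> 0 \<and> nview_block l F i j = c *\<^sub>R (V i ** skew e ** transpose (V j))"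
      using nview_factorization_collinear[OF sym[OF l] l0 rank_F ranks] by metis
    \<comment> \<open>Distinct parameters keep \<open>s i - s j\<close> nonzero, so this factor can
      be absorbed into the scale of \<open>F i j\<close>.\<close>
    obtain s :: "'n \<Rightarrow> real" where s: "inj s"
      using exists_inj_real by blast
    define t where "t i = s i *\<^sub>R e" for i
    have "\<exists>c. c \<noteq> 0 \<and> F i j = c *\<^sub>R (V i ** skew (t i - t j) ** transpose (V j))" if ij: "i \<noteq> j" for i j
    proof -
      obtain c where c: "c \<noteq> 0" "l i j *\<^sub>R F i j = c *\<^sub>R (V i ** skew e ** transpose (V j))"
        using V[OF ij] ij by (auto simp: nview_block_def)
      have "skew (t i - t j) = (s i - s j) *\<^sub>R skew e"
        by (simp add: t_def skew_scaleR flip: scaleR_left_diff_distrib)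
      then have G: "V i ** skew (t i - t j) ** transpose (V j) = (s i - s j) *\<^sub>R (V i ** skew e ** transpose (V j))"
        by (simp add: matrix_scalar_ac scalar_matrix_assoc)
      have "s i - s j \<noteq> 0"
        using s ij by (auto simp: inj_eq)
      moreover have "F i j = (c / l i j) *\<^sub>R (V i ** skew e ** transpose (V j))"
        using arg_cong[OF c(2), of "\<lambda>A. (1 / l i j) *\<^sub>R A"] l0[OF ij] by simp
      ultimately show ?thesis
        unfolding G using c(1) l0[OF ij] by (intro exI[of _ "c / l i j / (s i - s j)"]) simp
    qed
    then have "affine_solution F V t"
      by (simp add: affine_solution_def inv)
    moreover have "collinear (range t)"
      unfolding collinear_alt by (rule exI[of _ 0], rule exI[of _ e]) (auto simp: t_def)
    ultimately show ?C
      using affine_imp_solution by metis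
  qed
  moreover have "?N \<longleftrightarrow> ?N'"
  proof
    assume ?N
    then obtain V t where sol: "affine_solution F V t" and coll: "\<not> collinear (range t)"
      using solution_imp_affine by metis
    obtain l where l: "\<And>i j. i \<noteq> j \<Longrightarrow> l i j \<noteq> 0 \<and> l i j = l j i"
      and blocks: "\<And>i j. i \<noteq> j \<Longrightarrow> l i j *\<^sub>R F i j = V i ** skew (t i - t j) ** transpose (V j)"
      using affine_scaling[OF sol assms(3) nz] by metis
    have inv: "invertible (V i)" for i
      using sol by (simp add: affine_solution_def)
    note ranks = nview_rank_noncollinear[OF inv blocks coll]
    show ?N'
      using l ranks col[of l] by (intro exI[of _ l]) auto
  next
    assume ?N'
    then obtain l where l: "\<forall>i j. i \<noteq> j \<longrightarrow> l i j \<noteq> 0 \<and> l i j = l j i"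
      and ranks: "rank (nview_matrix l F) = 6" "\<And>i. rank (block_row (nview_matrix l F) i) = 3"
      by blast
    have l0: "l i j \<noteq> 0" if "i \<noteq> j" for i j
      using l that by blast
    obtain V t where inv: "\<And>i. invertible (V i)"
      and V: "\<And>i j. nview_block l F i j = V i ** skew (t i - t j) ** transpose (V j)"
      using nview_factorization_noncollinear[OF sym[OF l] l0 rank_F ranks] by metis
    have blocks: "l i j *\<^sub>R F i j = V i ** skew (t i - t j) ** transpose (V j)" if "i \<noteq> j" for i j
      using V[of i j] that by (simp add: nview_block_def)
    \<comment> \<open>Collinear centers would make the rank 4 instead of 6.\<close>
    have "\<not> collinear (range t)"
    proof
      assume coll: "collinear (range t)"
      have "t p \<noteq> t q"
        using ne l0 blocks by metis
      then have "rank (nview_matrix l F) = 4"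
        using nview_rank_collinear(1)[where V = V and t = t and l = l and F = F] inv blocks coll
        by blast
      with ranks(1) show False by simp
    qed
    moreover have "affine_solution F V t"
      unfolding affine_solution_def
    proof (intro conjI allI impI)
      fix i j :: 'n assume ij: "i \<noteq> j"
      have "F i j = (1 / l i j) *\<^sub>R (V i ** skew (t i - t j) ** transpose (V j))"
        using l0[OF ij] by (simp flip: blocks[OF ij])
      then show "\<exists>c. c \<noteq> 0 \<and> F i j = c *\<^sub>R (V i ** skew (t i - t j) ** transpose (V j))"
        using l0[OF ij] by (intro exI[of _ "1 / l i j"]) simp
    qed (rule inv)
    ultimately show ?N
      using affine_imp_solution by metis
  qed
  ultimately show ?thesis by blast
qed

end
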